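(* Let $k$ be a field of characteristic zero and $q \in k^{\times}$ not a root of unity. Let $D = k_q(x,y)$ and $L = k_q(y)(\!(x)\!) \supset D$. For $z \in L\setminus\{0\}$ write $c_z$ for the conjugation map $r \mapsto zrz^{-1}$. Then: (i) $D$ admits bijective conjugation maps by elements $z \in L \setminus D$, i.e. there are $z \in L\setminus D$ such that $c_z$ restricts to a bijection $D \to D$. These include examples for which $z^n \in D$ for some positive integer $n$, and also examples for which $z^n \notin D$ for all $n \geq 1$. (ii) $D$ also admits a $k$-algebra endomorphism which is not an automorphism and which can be represented in the form of a conjugation map; i.e. there is $z \in L\setminus\{0\}$ such that $c_z$ restricts to an endomorphism of $D$ that is not an automorphism of $D$.
   Context: $D=k_q(x,y)$ is the division ring of fractions of the quantum plane $k_q[x,y] = k\langle x,y\rangle/(xy-qyx)$. The ring $$L = k_q(y)(\!(x)\!) = \Big\{ \sum_{i \geq n} a_i x^i : n \in \mathbb{Z},\ a_i \in k(y)\Big\}$$ is the division ring of Laurent power series in $x$ with coefficients in $k(y)$, subject to the same relation $xy = qyx$; $D$ embeds naturally in $L$ and is identified with its image. *)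

theory Defs
  imports
    "HOL-Algebra.Generated_Rings"
    "HOL-Computational_Algebra.Polynomial"
    "HOL-Computational_Algebra.Fraction_Field"
    "HOL-Computational_Algebra.Formal_Laurent_Series"
begin

unbundle fps_syntax

section \<open>The automorphisms of the coefficient field\<close>

text \<open>
  The field \<open>k(y)\<close> is \<^typ>\<open>'a poly fract\<close>, with \<open>y\<close> the polynomial indeterminate.  The relation
  \<open>x y = q y x\<close> forces \<open>x\<^sup>i a(y) = a(q\<^sup>i y) x\<^sup>i\<close>; the map \<open>qdil c\<close> is \<open>a(y) \<mapsto> a(c y)\<close>.
  The value at \<open>c = 0\<close> is a dummy, as substituting \<open>0\<close> may annihilate the denominator.
\<close>

lift_definition qdil :: "'a::field \<Rightarrow> 'a poly fract \<Rightarrow> 'a poly fract" is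
  "\<lambda>c r. if c = 0 then (0, 1) else (pcompose (fst r) [:0, c:], pcompose (snd r) [:0, c:])"
proof -
  fix c :: 'a and r s :: "'a poly \<times> 'a poly"
  assume "fractrel r s"
  then have nz: "snd r \<noteq> 0" "snd s \<noteq> 0" and eq: "fst r * snd s = fst s * snd r" by auto
  have "pcompose p [:0, c:] \<noteq> 0" if "p \<noteq> 0" "c \<noteq> 0" for p
    using pcompose_eq_0[of p "[:0, c:]"] that by auto
  moreover have "pcompose (fst r) [:0, c:] * pcompose (snd s) [:0, c:]
      = pcompose (fst s) [:0, c:] * pcompose (snd r) [:0, c:]"
    using eq by (metis pcompose_mult)
  ultimately show "fractrel
      (if c = 0 then (0, 1) else (pcompose (fst r) [:0, c:], pcompose (snd r) [:0, c:]))
      (if c = 0 then (0, 1) else (pcompose (fst s) [:0, c:], pcompose (snd s) [:0, c:]))"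
    using nz by auto
qed

lemma pcompose_dil_eq_0_iff: "c \<noteq> 0 \<Longrightarrow> pcompose p [:0, c:] = 0 \<longleftrightarrow> p = 0"
  for c :: "'a::field"
  using pcompose_eq_0[of p "[:0, c:]"] by auto

lemma qdil_Fract:
  "c \<noteq> 0 \<Longrightarrow> b \<noteq> 0 \<Longrightarrow> qdil c (Fract a b) = Fract (pcompose a [:0, c:]) (pcompose b [:0, c:])"
  by (simp add: Fract_def qdil.abs_eq pcompose_dil_eq_0_iff)

lemma qdil_add: "c \<noteq> 0 \<Longrightarrow> qdil c (f + g) = qdil c f + qdil c g"
  by (cases f; cases g) (simp add: qdil_Fract pcompose_dil_eq_0_iff pcompose_add pcompose_mult)

lemma qdil_mult: "c \<noteq> 0 \<Longrightarrow> qdil c (f * g) = qdil c f * qdil c g"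
  by (cases f; cases g) (simp add: qdil_Fract pcompose_dil_eq_0_iff pcompose_mult)

lemma qdil_0 [simp]: "qdil c 0 = 0"
  by (cases "c = 0") (simp_all add: Zero_fract_def Fract_def qdil.abs_eq pcompose_1)

lemma qdil_one [simp]: "c \<noteq> 0 \<Longrightarrow> qdil c 1 = 1"
  by (simp add: One_fract_def qdil_Fract pcompose_1)

lemma qdil_qdil: "c \<noteq> 0 \<Longrightarrow> d \<noteq> 0 \<Longrightarrow> qdil c (qdil d f) = qdil (c * d) f"
proof (cases f)
  case (Fract a b)
  assume "c \<noteq> 0" "d \<noteq> 0"
  moreover have "pcompose (pcompose p [:0, d:]) [:0, c:] = pcompose p [:0, c * d:]" for p
    by (simp add: pcompose_assoc [symmetric] pcompose_pCons mult.commute)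
  ultimately show ?thesis
    using Fract by (simp add: qdil_Fract pcompose_dil_eq_0_iff)
qed

lemma qdil_1_left [simp]: "qdil 1 f = f"
  by (cases f) (simp add: qdil_Fract pcompose_idR)

lemma qdil_sum: "c \<noteq> 0 \<Longrightarrow> qdil c (sum f A) = (\<Sum>i\<in>A. qdil c (f i))"
  by (induction A rule: infinite_finite_induct) (simp_all add: qdil_add)


section \<open>The division ring of skew Laurent series\<close>

text \<open>
  A series \<open>\<Sum>i. a\<^sub>i x\<^sup>i\<close> over \<open>k(y)\<close> is an element of \<^typ>\<open>'a poly fract fls\<close>, whose additive
  structure is used; the commutative product of that type is not.  The product below is
  \<open>(\<Sum>i. a\<^sub>i x\<^sup>i) (\<Sum>j. b\<^sub>j x\<^sup>j) = (\<Sum>n. (\<Sum>i. a\<^sub>i(y) b\<^bsub>n-i\<^esub>(q\<^sup>i y)) x\<^sup>n)\<close>.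
\<close>

definition skew_mult ::
    "'a::field \<Rightarrow> 'a poly fract fls \<Rightarrow> 'a poly fract fls \<Rightarrow> 'a poly fract fls" where
  "skew_mult q f g = Abs_fls (\<lambda>n. \<Sum>i = fls_subdegree f..n - fls_subdegree g.
     f $$ i * qdil (q powi i) (g $$ (n - i)))"

definition qLaurent :: "'a::field \<Rightarrow> 'a poly fract fls ring" where
  "qLaurent q = \<lparr>carrier = UNIV, monoid.mult = skew_mult q, one = 1, zero = 0, add = (+)\<rparr>"

definition qscal :: "'a::field \<Rightarrow> 'a poly fract fls" where
  "qscal c = fls_const (Fract [:c:] 1)"

definition qx :: "'a::field poly fract fls" where
  "qx = fls_X"

definition qy :: "'a::field poly fract fls" where
  "qy = fls_const (Fract [:0, 1:] 1)"

text \<open>The image of \<open>k\<langle>x, y\<rangle>/(x y - q y x)\<close> in the Laurent series ring.\<close>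

definition qplane :: "'a::field \<Rightarrow> 'a poly fract fls set" where
  "qplane q = generate_ring (qLaurent q) (range qscal \<union> {qx, qy})"

text \<open>The quantum plane is an Ore domain, so its division ring of fractions consists of the
  right fractions \<open>a b\<^sup>-\<^sup>1\<close>, and its image in the Laurent series ring is the following.\<close>

definition qdiv :: "'a::field \<Rightarrow> 'a poly fract fls set" where
  "qdiv q = {a \<otimes>\<^bsub>qLaurent q\<^esub> inv\<^bsub>qLaurent q\<^esub> b | a b.
     a \<in> qplane q \<and> b \<in> qplane q \<and> b \<noteq> \<zero>\<^bsub>qLaurent q\<^esub>}"

definition qdiv_ring :: "'a::field \<Rightarrow> 'a poly fract fls ring" where
  "qdiv_ring q = (qLaurent q)\<lparr>carrier := qdiv q\<rparr>"

definition qconj :: "'a::field \<Rightarrow> 'a poly fract fls \<Rightarrow> 'a poly fract fls \<Rightarrow> 'a poly fract fls" where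
  "qconj q z r = z \<otimes>\<^bsub>qLaurent q\<^esub> r \<otimes>\<^bsub>qLaurent q\<^esub> inv\<^bsub>qLaurent q\<^esub> z"

definition qdiv_End :: "'a::field \<Rightarrow> ('a poly fract fls \<Rightarrow> 'a poly fract fls) set" where
  "qdiv_End q = {\<phi> \<in> ring_hom (qdiv_ring q) (qdiv_ring q).
     \<forall>c. \<forall>r\<in>qdiv q. \<phi> (qscal c \<otimes>\<^bsub>qLaurent q\<^esub> r) = qscal c \<otimes>\<^bsub>qLaurent q\<^esub> \<phi> r}"

definition qdiv_Aut :: "'a::field \<Rightarrow> ('a poly fract fls \<Rightarrow> 'a poly fract fls) set" where
  "qdiv_Aut q = {\<phi> \<in> qdiv_End q. bij_betw \<phi> (qdiv q) (qdiv q)}"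


section \<open>Basic facts\<close>

lemma qLaurent_simps [simp]:
  "carrier (qLaurent q) = UNIV" "monoid.mult (qLaurent q) = skew_mult q" "one (qLaurent q) = 1"
  "zero (qLaurent q) = 0" "add (qLaurent q) = (+)"
  by (simp_all add: qLaurent_def)

lemma skew_mult_nth:
  "skew_mult q f g $$ n = (\<Sum>i = fls_subdegree f..n - fls_subdegree g.
     f $$ i * qdil (q powi i) (g $$ (n - i)))"
  unfolding skew_mult_def
  by (subst nth_Abs_fls_lower_bound[of "fls_subdegree f + fls_subdegree g"]) auto

lemma skew_mult_nth':
  assumes "finite I" "\<And>i. f $$ i \<noteq> 0 \<Longrightarrow> g $$ (n - i) \<noteq> 0 \<Longrightarrow> i \<in> I"
  shows "skew_mult q f g $$ n = (\<Sum>i\<in>I. f $$ i * qdil (q powi i) (g $$ (n - i)))"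
proof -
  let ?t = "\<lambda>i. f $$ i * qdil (q powi i) (g $$ (n - i))"
  let ?J = "{i. f $$ i \<noteq> 0 \<and> g $$ (n - i) \<noteq> 0}"
  have z: "?t i = 0" if "i \<notin> ?J" for i using that by auto
  have J: "?J \<subseteq> {fls_subdegree f..n - fls_subdegree g}"
  proof
    fix i assume "i \<in> ?J"
    then show "i \<in> {fls_subdegree f..n - fls_subdegree g}"
      using fls_subdegree_leI[of f i] fls_subdegree_leI[of g "n - i"] by simp
  qed
  have "sum ?t {fls_subdegree f..n - fls_subdegree g} = sum ?t ?J"
    by (rule sum.mono_neutral_right) (use z J in auto)
  moreover have "sum ?t I = sum ?t ?J"
    by (rule sum.mono_neutral_right) (use z assms in auto)
  ultimately show ?thesis by (simp add: skew_mult_nth)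
qed

lemma skew_mult_window:
  assumes "A \<le> fls_subdegree f" "B \<le> fls_subdegree g" "n - B \<le> C"
  shows "skew_mult q f g $$ n = (\<Sum>i = A..C. f $$ i * qdil (q powi i) (g $$ (n - i)))"
  by (rule skew_mult_nth')
    (use assms fls_subdegree_leI[of f] fls_subdegree_leI[of g] in fastforce)+

lemma skew_mult_const_left: "skew_mult q (fls_const c) g $$ n = c * g $$ n"
  by (subst skew_mult_nth'[of "{0}"]) (auto split: if_splits)

lemma skew_mult_X_left: "skew_mult q fls_X g $$ n = qdil q (g $$ (n - 1))"
  by (subst skew_mult_nth'[of "{1}"]) (auto split: if_splits)

lemma skew_mult_const_right: "skew_mult q f (fls_const c) $$ n = f $$ n * qdil (q powi n) c"
  by (subst skew_mult_nth'[of "{n}"]) (auto split: if_splits)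

lemma qx_qy: "q \<noteq> 0 \<Longrightarrow> skew_mult q qx qy = skew_mult q (qscal q) (skew_mult q qy qx)"
  by (rule fls_eqI)
    (simp add: qx_def qy_def qscal_def skew_mult_X_left skew_mult_const_left qdil_Fract
      pcompose_pCons pcompose_1)

lemma skew_mult_add_right:
  assumes "q \<noteq> 0"
  shows "skew_mult q f (g + h) = skew_mult q f g + skew_mult q f h"
proof (rule fls_eqI)
  fix n
  define B where "B = min (fls_subdegree (g + h)) (min (fls_subdegree g) (fls_subdegree h))"
  have "skew_mult q f u $$ n
      = (\<Sum>i = fls_subdegree f..n - B. f $$ i * qdil (q powi i) (u $$ (n - i)))"
    if "u \<in> {g, h, g + h}" for u
    by (rule skew_mult_window[where B = B]) (use that in \<open>auto simp: B_def\<close>)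
  then show "skew_mult q f (g + h) $$ n = (skew_mult q f g + skew_mult q f h) $$ n"
    using assms by (simp add: qdil_add ring_distribs sum.distrib)
qed

lemma skew_mult_add_left: "skew_mult q (f + g) h = skew_mult q f h + skew_mult q g h"
proof (rule fls_eqI)
  fix n
  define A where "A = min (fls_subdegree (f + g)) (min (fls_subdegree f) (fls_subdegree g))"
  have "skew_mult q u h $$ n
      = (\<Sum>i = A..n - fls_subdegree h. u $$ i * qdil (q powi i) (h $$ (n - i)))"
    if "u \<in> {f, g, f + g}" for u
    by (rule skew_mult_window[where B = "fls_subdegree h"]) (use that in \<open>auto simp: A_def\<close>)
  then show "skew_mult q (f + g) h $$ n = (skew_mult q f h + skew_mult q g h) $$ n"
    by (simp add: ring_distribs sum.distrib)
qed

lemma skew_mult_1 [simp]: "q \<noteq> 0 \<Longrightarrow> skew_mult q 1 f = f" "q \<noteq> 0 \<Longrightarrow> skew_mult q f 1 = f"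
  using skew_mult_const_left[of q 1 f] skew_mult_const_right[of q f 1]
  by (auto intro!: fls_eqI)

lemma skew_mult_eq_0_below:
  assumes "n < fls_subdegree f + fls_subdegree g"
  shows "skew_mult q f g $$ n = 0"
  using assms by (simp add: skew_mult_nth)

lemma skew_mult_assoc:
  assumes q: "q \<noteq> 0"
  shows "skew_mult q (skew_mult q f g) h = skew_mult q f (skew_mult q g h)"
proof (rule fls_eqI)
  fix n
  define a b c where "a = fls_subdegree f" "b = fls_subdegree g" "c = fls_subdegree h"
  note d = this
  let ?t = "\<lambda>i j. f $$ i * qdil (q powi i) (g $$ j) * qdil (q powi (i + j)) (h $$ (n - i - j))"
  have "skew_mult q (skew_mult q f g) h $$ n
      = (\<Sum>m = a + b..n - c. skew_mult q f g $$ m * qdil (q powi m) (h $$ (n - m)))"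
  proof (rule skew_mult_nth')
    fix m assume "skew_mult q f g $$ m \<noteq> 0" "h $$ (n - m) \<noteq> 0"
    then show "m \<in> {a + b..n - c}"
      using skew_mult_eq_0_below[of m f g q] fls_subdegree_leI[of h "n - m"]
      unfolding d by force
  qed simp
  also have "\<dots> = (\<Sum>m = a + b..n - c. \<Sum>i = a..n - b - c. ?t i (m - i))"
  proof (rule sum.cong[OF refl])
    fix m assume "m \<in> {a + b..n - c}"
    then have "skew_mult q f g $$ m
        = (\<Sum>i = a..n - b - c. f $$ i * qdil (q powi i) (g $$ (m - i)))"
      by (intro skew_mult_window[where B = b]) (auto simp: d)
    then show "skew_mult q f g $$ m * qdil (q powi m) (h $$ (n - m))
        = (\<Sum>i = a..n - b - c. ?t i (m - i))"
      by (simp add: sum_distrib_right)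
  qed
  also have "\<dots> = (\<Sum>i = a..n - b - c. \<Sum>m = a + b..n - c. ?t i (m - i))"
    by (rule sum.swap)
  also have "\<dots> = (\<Sum>i = a..n - b - c. \<Sum>j = b..n - i - c. ?t i j)"
  proof (rule sum.cong[OF refl])
    fix i assume i: "i \<in> {a..n - b - c}"
    have "(\<Sum>m = a + b..n - c. ?t i (m - i)) = (\<Sum>m = i + b..n - c. ?t i (m - i))"
      by (rule sum.mono_neutral_right) (use i in \<open>auto simp: d\<close>)
    also have "\<dots> = (\<Sum>j = b..n - i - c. ?t i j)"
      by (rule sum.reindex_bij_witness[of _ "\<lambda>j. j + i" "\<lambda>m. m - i"]) auto
    finally show "(\<Sum>m = a + b..n - c. ?t i (m - i)) = (\<Sum>j = b..n - i - c. ?t i j)" .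
  qed
  also have "\<dots> = (\<Sum>i = a..n - b - c. f $$ i * qdil (q powi i) (skew_mult q g h $$ (n - i)))"
    using q
    by (intro sum.cong refl)
      (simp add: skew_mult_nth d qdil_sum qdil_mult qdil_qdil sum_distrib_left
        power_int_add mult.assoc)
  also have "\<dots> = skew_mult q f (skew_mult q g h) $$ n"
  proof (rule skew_mult_nth'[symmetric])
    fix i assume "f $$ i \<noteq> 0" "skew_mult q g h $$ (n - i) \<noteq> 0"
    then show "i \<in> {a..n - b - c}"
      using skew_mult_eq_0_below[of "n - i" g h q] fls_subdegree_leI[of f i]
      unfolding d by force
  qed simp
  finally show "skew_mult q (skew_mult q f g) h $$ n = skew_mult q f (skew_mult q g h) $$ n" .
qed

lemma ring_qLaurent: "q \<noteq> 0 \<Longrightarrow> ring (qLaurent q)"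
proof (intro ringI abelian_groupI monoidI)
  fix f :: "'a poly fract fls"
  show "\<exists>g\<in>carrier (qLaurent q). g \<oplus>\<^bsub>qLaurent q\<^esub> f = \<zero>\<^bsub>qLaurent q\<^esub>"
    by (auto intro: exI[of _ "- f"])
qed (auto simp: skew_mult_assoc skew_mult_add_left skew_mult_add_right algebra_simps)

lemma skew_mult_right_inverse:
  assumes q: "q \<noteq> 0" and f: "f \<noteq> 0"
  shows "\<exists>g. g \<noteq> 0 \<and> skew_mult q f g = 1"
proof -
  define m where "m = fls_subdegree f"
  define step where "step h n = qdil (q powi (- m)) (inverse (f $$ m) *
      ((if n = 0 then 1 else 0)
       - (\<Sum>j<n. f $$ (m + int (n - j)) * qdil (q powi (m + int (n - j))) (h j))))"
    for h :: "nat \<Rightarrow> 'a poly fract" and n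
  define h where "h = wfrec less_than (\<lambda>h n. step h n)"
  have h: "h n = step h n" for n
  proof -
    have "h n = step (cut h less_than n) n"
      unfolding h_def by (subst wfrec[OF wf_less_than]) simp
    also have "\<dots> = step h n"
      by (simp add: step_def cut_def)
    finally show ?thesis .
  qed
  define g where "g = Abs_fls (\<lambda>n. if n < - m then 0 else h (nat (n + m)))"
  have gn: "g $$ n = (if n < - m then 0 else h (nat (n + m)))" for n
    unfolding g_def by (subst nth_Abs_fls_lower_bound[of "- m"]) auto
  have fm: "f $$ m \<noteq> 0" using f by (simp add: m_def)
  have eq: "skew_mult q f g $$ n = (if n = 0 then 1 else 0)" for n
  proof (cases "n < 0")
    case True
    have "skew_mult q f g $$ n = (\<Sum>i\<in>{}. f $$ i * qdil (q powi i) (g $$ (n - i)))"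
    proof (rule skew_mult_nth')
      fix i assume "f $$ i \<noteq> 0" "g $$ (n - i) \<noteq> 0"
      then show "i \<in> {}"
        using True fls_subdegree_leI[of f i] by (auto simp: gn m_def split: if_splits)
    qed simp
    then show ?thesis using True by simp
  next
    case False
    define N where "N = nat n"
    have n: "n = int N" using False by (simp add: N_def)
    have "skew_mult q f g $$ n = (\<Sum>i = m..m + n. f $$ i * qdil (q powi i) (g $$ (n - i)))"
    proof (rule skew_mult_nth')
      fix i assume "f $$ i \<noteq> 0" "g $$ (n - i) \<noteq> 0"
      then show "i \<in> {m..m + n}"
        using fls_subdegree_leI[of f i] by (auto simp: gn m_def split: if_splits)
    qed simp
    also have "\<dots> = (\<Sum>j\<le>N. f $$ (m + int (N - j)) * qdil (q powi (m + int (N - j))) (h j))"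
      by (rule sum.reindex_bij_witness[of _ "\<lambda>j. m + int (N - j)" "\<lambda>i. nat (n - i + m)"])
        (auto simp: n gn)
    also have "\<dots> = (\<Sum>j<N. f $$ (m + int (N - j)) * qdil (q powi (m + int (N - j))) (h j))
        + f $$ m * qdil (q powi m) (h N)"
      by (simp add: lessThan_Suc_atMost[symmetric])
    also have "f $$ m * qdil (q powi m) (h N) = (if N = 0 then 1 else 0)
       - (\<Sum>j<N. f $$ (m + int (N - j)) * qdil (q powi (m + int (N - j))) (h j))"
      using q fm
      by (subst h) (simp add: step_def qdil_qdil power_int_add[symmetric] mult.assoc[symmetric])
    finally show ?thesis by (simp add: n)
  qed
  have "skew_mult q f g = 1" by (rule fls_eqI) (simp add: eq)
  moreover have "g \<noteq> 0"
  proof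
    assume "g = 0"
    then have "skew_mult q f g $$ 0 = 0" by (simp add: skew_mult_nth)
    with eq[of 0] show False by simp
  qed
  ultimately show ?thesis by blast
qed

text \<open>Every nonzero series is invertible, so \<^const>\<open>m_inv\<close> has its intended meaning on all of
  them.\<close>

lemma Units_qLaurent:
  assumes q: "q \<noteq> 0"
  shows "Units (qLaurent q) = carrier (qLaurent q) - {\<zero>\<^bsub>qLaurent q\<^esub>}"
proof (intro Set.set_eqI iffI)
  fix f :: "'a poly fract fls"
  assume "f \<in> Units (qLaurent q)"
  then obtain g where "skew_mult q f g = 1" by (auto simp: Units_def)
  moreover have "skew_mult q 0 g = 0" by (rule fls_eqI) (simp add: skew_mult_nth)
  ultimately show "f \<in> carrier (qLaurent q) - {\<zero>\<^bsub>qLaurent q\<^esub>}" by auto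
next
  fix f :: "'a poly fract fls"
  assume "f \<in> carrier (qLaurent q) - {\<zero>\<^bsub>qLaurent q\<^esub>}"
  then obtain g where g: "g \<noteq> 0" "skew_mult q f g = 1"
    using skew_mult_right_inverse[OF q, of f] by auto
  obtain h where h: "skew_mult q g h = 1"
    using skew_mult_right_inverse[OF q g(1)] by auto
  have "f = skew_mult q f (skew_mult q g h)" by (simp add: h q)
  also have "\<dots> = h" using q by (simp add: skew_mult_assoc[symmetric] g)
  finally have "skew_mult q g f = 1" using h by simp
  then show "f \<in> Units (qLaurent q)" using g by (auto simp: Units_def)
qed

end

theory Submission
  imports Defs
begin

text \<open>
  Write \<open>k\<close>, \<open>D\<close> and \<open>L\<close> for the field, the division ring of fractions of the quantum plane and the
  division ring of skew Laurent series, and \<open>c\<^sub>z\<close> for conjugation by \<open>z\<close>.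

  All three conjugations come from pairs \<open>(Y, u)\<close> with \<open>u Y = q Y u\<close> and \<open>Y = y + O(x)\<close>.  As
  \<open>q\<^sup>n \<noteq> 1\<close> for \<open>n \<noteq> 0\<close>, the equation \<open>z y = Y z\<close> can be solved in \<open>L\<close> coefficient by coefficient,
  starting from the constant term \<open>1\<close>.  Then \<open>z\<^sup>-\<^sup>1 u z\<close> satisfies the same commutation rule with \<open>y\<close> as
  \<open>x\<close> does, so it is \<open>a(y) x\<close>, and \<open>c\<^sub>z(D)\<close> is the division ring generated by \<open>k\<close>, \<open>Y\<close> and \<open>u\<close>
  (\<open>q_pair_conj\<close>).

  For \<open>Y = (1 + x) y\<close> and \<open>u = x\<close> this gives a \<open>z\<close> that commutes with \<open>x\<close> and for which \<open>c\<^sub>z\<close> permutes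
  \<open>D\<close>.  Conjugation by \<open>z\<^sup>n\<close> takes \<open>y\<close> to \<open>(1 + x)\<^sup>n y\<close>, of degree \<open>n\<close> in \<open>x\<close>.  The degree in \<open>x\<close>
  extends from Laurent polynomials to \<open>D\<close> and is invariant under conjugation in \<open>D\<close>, so no \<open>z\<^sup>n\<close> with
  \<open>n \<ge> 1\<close> lies in \<open>D\<close> (\<open>has_deg_of_twist\<close>).

  The other two come from the involution \<open>\<tau>\<close> of \<open>D\<close> that inverts \<open>x\<close> and \<open>y\<close>.  The element
  \<open>Y = (1 - x)\<^sup>-\<^sup>1 (y - x y\<^sup>-\<^sup>1)\<close> is fixed by \<open>\<tau>\<close>, and with \<open>A = y + y\<^sup>-\<^sup>1\<close> and
  \<open>u = A Y - Y\<^sup>2 - 1\<close> it forms a pair as above.  For the corresponding \<open>z\<close>, the division ring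
  \<open>E = c\<^sub>z(D)\<close> consists of elements of \<open>D\<close> fixed by \<open>\<tau>\<close>, so \<open>y \<notin> E\<close> and \<open>c\<^sub>z\<close> is an endomorphism of
  \<open>D\<close> that is not surjective (\<open>ex_nonsurjective\<close>).

  Finally let \<open>B = x + x\<^sup>-\<^sup>1\<close> and \<open>h = x - x\<^sup>-\<^sup>1\<close>.  Since \<open>\<tau>\<close> takes \<open>h\<close> to \<open>- h\<close>, it is not in \<open>E\<close>, but
  \<open>h\<^sup>2 = B\<^sup>2 - 4\<close> is, because \<open>B \<in> E\<close> (\<open>AB_in\<close>); and \<open>c\<^sub>h\<close> maps \<open>E\<close> to itself (\<open>h_normalises\<close>).
  Transporting \<open>h\<close> back along \<open>c\<^sub>z\<close>, the element \<open>v = z\<^sup>-\<^sup>1 h z\<close> is not in \<open>D\<close>, its square is in \<open>D\<close>,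
  and \<open>c\<^sub>v\<close> permutes \<open>D\<close> (\<open>ex_bijective_square\<close>).
\<close>

section \<open>Arithmetic of skew Laurent series\<close>

locale quantum_torus =
  fixes q :: "'a::field_char_0"
  assumes q_nz: "q \<noteq> 0"
    and q_pow: "\<And>n::nat. n > 0 \<Longrightarrow> q ^ n \<noteq> 1"
begin

abbreviation mul :: "'a poly fract fls \<Rightarrow> 'a poly fract fls \<Rightarrow> 'a poly fract fls"
  (infixl "\<cdot>" 70) where "f \<cdot> g \<equiv> skew_mult q f g"

abbreviation iv :: "'a poly fract fls \<Rightarrow> 'a poly fract fls" where
  "iv \<equiv> m_inv (qLaurent q)"

lemma q_powi_nz [simp]: "q powi n \<noteq> 0"
  using q_nz by simp

lemma q_powi_eq_1_iff: "q powi n = 1 \<longleftrightarrow> n = 0"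
proof
  assume *: "q powi n = 1"
  show "n = 0"
  proof (rule ccontr)
    assume "n \<noteq> 0"
    then have "q ^ nat \<bar>n\<bar> = 1"
      using * by (auto simp: power_int_def power_inverse split: if_splits)
    with q_pow[of "nat \<bar>n\<bar>"] \<open>n \<noteq> 0\<close> show False by simp
  qed
qed simp

lemma assoc: "f \<cdot> g \<cdot> h = f \<cdot> (g \<cdot> h)"
  by (rule skew_mult_assoc[OF q_nz])

lemma add_right: "f \<cdot> (g + h) = f \<cdot> g + f \<cdot> h"
  by (rule skew_mult_add_right[OF q_nz])

lemmas add_left = skew_mult_add_left

lemma one_left [simp]: "1 \<cdot> f = f" and one_right [simp]: "f \<cdot> 1 = f"
  using skew_mult_1[OF q_nz] by auto

lemma zero_left [simp]: "0 \<cdot> f = 0"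
  by (rule fls_eqI) (simp add: skew_mult_nth)

lemma zero_right [simp]: "f \<cdot> 0 = 0"
  by (rule fls_eqI) (simp add: skew_mult_nth)

lemma minus_left: "(- f) \<cdot> g = - (f \<cdot> g)"
  using add_left[of q f "- f" g] by (simp add: eq_neg_iff_add_eq_0 add.commute)

lemma minus_right: "f \<cdot> (- g) = - (f \<cdot> g)"
  using add_right[of f g "- g"] by (simp add: eq_neg_iff_add_eq_0 add.commute)

lemma diff_left: "(f - g) \<cdot> h = f \<cdot> h - g \<cdot> h"
  using add_left[of q f "- g" h] by (simp add: minus_left)

lemma diff_right: "f \<cdot> (g - h) = f \<cdot> g - f \<cdot> h"
  using add_right[of f g "- h"] by (simp add: minus_right)

lemmas distribs = add_left add_right diff_left diff_right minus_left minus_right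

lemma iv_right [simp]: "f \<noteq> 0 \<Longrightarrow> f \<cdot> iv f = 1"
  and iv_left [simp]: "f \<noteq> 0 \<Longrightarrow> iv f \<cdot> f = 1"
proof -
  interpret R: ring "qLaurent q" by (rule ring_qLaurent[OF q_nz])
  show "f \<noteq> 0 \<Longrightarrow> f \<cdot> iv f = 1" "f \<noteq> 0 \<Longrightarrow> iv f \<cdot> f = 1"
    using R.Units_r_inv[of f] R.Units_l_inv[of f] by (auto simp: Units_qLaurent[OF q_nz])
qed

lemma iv_left_assoc [simp]: "f \<noteq> 0 \<Longrightarrow> iv f \<cdot> (f \<cdot> g) = g"
  and iv_right_assoc [simp]: "f \<noteq> 0 \<Longrightarrow> f \<cdot> (iv f \<cdot> g) = g"
  by (simp_all add: assoc[symmetric])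

lemma mul_eq_0_iff [simp]: "f \<cdot> g = 0 \<longleftrightarrow> f = 0 \<or> g = 0"
  by (metis iv_left_assoc zero_left zero_right)

lemma left_cancel: "f \<noteq> 0 \<Longrightarrow> f \<cdot> g = f \<cdot> h \<longleftrightarrow> g = h"
  by (metis iv_left_assoc)

lemma right_cancel: "f \<noteq> 0 \<Longrightarrow> g \<cdot> f = h \<cdot> f \<longleftrightarrow> g = h"
  by (metis iv_right assoc one_right)

lemma iv_nz [simp]: "f \<noteq> 0 \<Longrightarrow> iv f \<noteq> 0"
  using iv_right[of f] by force

lemma iv_unique: "f \<noteq> 0 \<Longrightarrow> f \<cdot> g = 1 \<Longrightarrow> iv f = g"
  by (metis iv_left_assoc one_right)

lemma iv_iv [simp]: "f \<noteq> 0 \<Longrightarrow> iv (iv f) = f"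
  by (rule iv_unique) auto

lemma iv_mul: "f \<noteq> 0 \<Longrightarrow> g \<noteq> 0 \<Longrightarrow> iv (f \<cdot> g) = iv g \<cdot> iv f"
  by (rule iv_unique) (auto simp: assoc)

lemma qdil_simps [simp]:
  "qdil (q powi i) 1 = 1" "qdil (q powi i) (f + g) = qdil (q powi i) f + qdil (q powi i) g"
  "qdil (q powi i) (f * g) = qdil (q powi i) f * qdil (q powi i) g"
  "qdil (q powi i) (qdil (q powi j) f) = qdil (q powi (i + j)) f"
  using q_nz by (simp_all add: qdil_add qdil_mult qdil_qdil power_int_add)

lemma qdil_minus [simp]: "qdil (q powi i) (- f) = - qdil (q powi i) f"
  using qdil_simps(2)[of i f "- f"] by (simp add: eq_neg_iff_add_eq_0 add.commute)

lemma qdil_eq_0_iff [simp]: "qdil (q powi i) f = 0 \<longleftrightarrow> f = 0"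
proof
  assume "qdil (q powi i) f = 0"
  then have "qdil (q powi (- i)) (qdil (q powi i) f) = 0" by simp
  then show "f = 0" unfolding qdil_simps by simp
qed simp

lemma qdil_inverse [simp]: "qdil (q powi i) (inverse f) = inverse (qdil (q powi i) f)"
proof (cases "f = 0")
  case False
  then have "qdil (q powi i) f * qdil (q powi i) (inverse f) = 1"
    by (simp flip: qdil_simps(3))
  then show ?thesis by (metis inverse_unique)
qed simp

lemma qdil_divide [simp]: "qdil (q powi i) (f / g) = qdil (q powi i) f / qdil (q powi i) g"
  by (simp add: divide_inverse)

text \<open>
  The monomial \<open>a x\<^sup>n\<close>, with its coefficient on the left.
\<close>

definition mon :: "'a poly fract \<Rightarrow> int \<Rightarrow> 'a poly fract fls" where
  "mon a n = Abs_fls (\<lambda>i. if i = n then a else 0)"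

lemma mon_nth: "mon a n $$ i = (if i = n then a else 0)"
  unfolding mon_def by (subst nth_Abs_fls_lower_bound[of n]) auto

lemma mon_0 [simp]: "mon 0 n = 0"
  by (rule fls_eqI) (simp add: mon_nth)

lemma mon_eq_0_iff [simp]: "mon a n = 0 \<longleftrightarrow> a = 0"
  by (auto simp: fls_eq_iff mon_nth)

lemma mon_mul_nth: "(mon a i \<cdot> f) $$ n = a * qdil (q powi i) (f $$ (n - i))"
  by (subst skew_mult_nth'[of "{i}"]) (auto simp: mon_nth split: if_splits)

lemma mul_mon_nth: "(f \<cdot> mon a i) $$ n = f $$ (n - i) * qdil (q powi (n - i)) a"
  by (subst skew_mult_nth'[of "{n - i}"]) (auto simp: mon_nth split: if_splits)

lemma mon_mul_mon: "mon a i \<cdot> mon b j = mon (a * qdil (q powi i) b) (i + j)"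
  by (rule fls_eqI) (auto simp: mon_mul_nth mon_nth)

text \<open>
  The scalars and the indeterminate \<open>y\<close> as elements of the coefficient field \<open>k(y)\<close>.
\<close>

definition cst :: "'a \<Rightarrow> 'a poly fract" where "cst c = Fract [:c:] 1"
definition yc :: "'a poly fract" where "yc = Fract [:0, 1:] 1"

lemma qdil_cst [simp]: "qdil (q powi i) (cst c) = cst c"
  using q_nz by (simp add: cst_def qdil_Fract pcompose_const pcompose_1)

lemma qdil_yc [simp]: "qdil (q powi i) yc = cst (q powi i) * yc"
  using q_nz by (simp add: yc_def cst_def qdil_Fract pcompose_pCons pcompose_1)

lemma cst_simps: "cst 0 = 0" "cst 1 = 1" "cst (a + b) = cst a + cst b" "cst (a * b) = cst a * cst b"
   "cst (- a) = - cst a" "cst (a - b) = cst a - cst b"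
  by (simp_all add: cst_def Zero_fract_def One_fract_def one_pCons mult.commute)

lemma cst_eq_iff [simp]: "cst a = cst b \<longleftrightarrow> a = b"
  by (simp add: cst_def eq_fract)

lemma yc_nz [simp]: "yc \<noteq> 0"
  by (simp add: yc_def Zero_fract_def eq_fract)

lemma mon_simps: "qscal c = mon (cst c) 0" "qx = mon 1 1" "qy = mon yc 0" "1 = mon 1 0"
  by (auto simp: fls_eq_iff mon_nth qscal_def cst_def qx_def qy_def yc_def)

section \<open>Skew Laurent polynomials and the Ore condition\<close>

text \<open>
  Series are bounded below anyway, so a bound above makes the support finite.
\<close>

definition laurent_polys :: "'a poly fract fls set" where
  "laurent_polys = {f. \<exists>N. \<forall>i>N. f $$ i = 0}"

definition has_deg :: "'a poly fract fls \<Rightarrow> int \<Rightarrow> bool" where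
  "has_deg f n \<longleftrightarrow> f $$ n \<noteq> 0 \<and> (\<forall>i>n. f $$ i = 0)"

lemma has_deg_unique: "has_deg f m \<Longrightarrow> has_deg f n \<Longrightarrow> m = n"
  unfolding has_deg_def by (metis linorder_neqE)

lemma has_deg_mul:
  assumes "has_deg f m" "has_deg g n"
  shows "has_deg (f \<cdot> g) (m + n)"
  unfolding has_deg_def
proof (intro conjI allI impI)
  have "(f \<cdot> g) $$ (m + n) = (\<Sum>i\<in>{m}. f $$ i * qdil (q powi i) (g $$ (m + n - i)))"
  proof (rule skew_mult_nth')
    fix i assume "f $$ i \<noteq> 0" "g $$ (m + n - i) \<noteq> 0"
    then have "\<not> i > m" "\<not> m + n - i > n" using assms by (auto simp: has_deg_def)
    then show "i \<in> {m}" by simp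
  qed simp
  then show "(f \<cdot> g) $$ (m + n) \<noteq> 0" using assms by (simp add: has_deg_def)
next
  fix k assume k: "k > m + n"
  have "(f \<cdot> g) $$ k = (\<Sum>i\<in>{}. f $$ i * qdil (q powi i) (g $$ (k - i)))"
  proof (rule skew_mult_nth')
    fix i assume "f $$ i \<noteq> 0" "g $$ (k - i) \<noteq> 0"
    then have "\<not> i > m" "\<not> k - i > n" using assms by (auto simp: has_deg_def)
    then show "i \<in> {}" using k by simp
  qed simp
  then show "(f \<cdot> g) $$ k = 0" by simp
qed

lemma laurent_polys_finite_support: "f \<in> laurent_polys \<longleftrightarrow> finite {i. f $$ i \<noteq> 0}"
proof
  assume "f \<in> laurent_polys"
  then obtain N where "\<forall>i>N. f $$ i = 0" by (auto simp: laurent_polys_def)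
  then have "{i. f $$ i \<noteq> 0} \<subseteq> {fls_subdegree f..N}"
    by (metis (mono_tags, lifting) atLeastAtMost_iff fls_subdegree_leI leI mem_Collect_eq subsetI)
  then show "finite {i. f $$ i \<noteq> 0}" by (rule finite_subset) simp
next
  assume *: "finite {i. f $$ i \<noteq> 0}"
  have "f $$ i = 0" if "i > Max (insert 0 {i. f $$ i \<noteq> 0})" for i
    using that Max_ge[of "insert 0 {i. f $$ i \<noteq> 0}" i] * by (metis (mono_tags, lifting)
      finite_insert insertCI leD mem_Collect_eq)
  then show "f \<in> laurent_polys" unfolding laurent_polys_def by blast
qed

lemma laurent_polys_has_deg:
  assumes "f \<in> laurent_polys" "f \<noteq> 0"
  shows "\<exists>n. has_deg f n"
proof -
  let ?I = "{i. f $$ i \<noteq> 0}"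
  have fin: "finite ?I" using assms(1) by (simp add: laurent_polys_finite_support)
  have "?I \<noteq> {}" using assms(2) by (auto simp: fls_eq_iff)
  then have "Max ?I \<in> ?I" using fin Max_in by blast
  moreover have "f $$ i = 0" if "i > Max ?I" for i
    using that Max_ge[OF fin, of i] by (metis (mono_tags, lifting) leD mem_Collect_eq)
  ultimately show ?thesis unfolding has_deg_def by blast
qed

lemma laurent_polys_mon [simp, intro]: "mon a n \<in> laurent_polys"
  by (auto simp: laurent_polys_def mon_nth)

lemma laurent_polys_0 [simp, intro]: "0 \<in> laurent_polys"
  by (simp add: laurent_polys_def)

lemma laurent_polys_1 [simp, intro]: "1 \<in> laurent_polys"
  unfolding mon_simps by (rule laurent_polys_mon)

lemma laurent_polys_uminus [intro]: "f \<in> laurent_polys \<Longrightarrow> - f \<in> laurent_polys"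
  by (simp add: laurent_polys_def)

lemma laurent_polys_add [intro]: "f \<in> laurent_polys \<Longrightarrow> g \<in> laurent_polys \<Longrightarrow> f + g \<in> laurent_polys"
  unfolding laurent_polys_finite_support
  by (rule finite_subset[of _ "{i. f $$ i \<noteq> 0} \<union> {i. g $$ i \<noteq> 0}"]) auto

lemma laurent_polys_diff [intro]: "f \<in> laurent_polys \<Longrightarrow> g \<in> laurent_polys \<Longrightarrow> f - g \<in> laurent_polys"
  using laurent_polys_add[of f "- g"] laurent_polys_uminus[of g] by simp

lemma laurent_polys_mul [intro]:
  assumes "f \<in> laurent_polys" "g \<in> laurent_polys"
  shows "f \<cdot> g \<in> laurent_polys"
proof (cases "f = 0 \<or> g = 0")
  case False
  then obtain m n where "has_deg f m" "has_deg g n" using assms laurent_polys_has_deg by metis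
  then have "has_deg (f \<cdot> g) (m + n)" by (rule has_deg_mul)
  then show ?thesis by (auto simp: has_deg_def laurent_polys_def)
qed (use laurent_polys_0 in \<open>metis mul_eq_0_iff\<close>)

definition supp_in :: "'a poly fract fls \<Rightarrow> int \<Rightarrow> int \<Rightarrow> bool" where
  "supp_in f l u \<longleftrightarrow> (\<forall>i. f $$ i \<noteq> 0 \<longrightarrow> l \<le> i \<and> i \<le> u)"

text \<open>
  The step of Euclidean division: a monomial right multiple of the shorter series \<open>b\<close> removes the leading
  coefficient of \<open>a\<close> without leaving the window of \<open>a\<close>.
\<close>

lemma cancel_top:
  assumes a: "supp_in a l u" and b: "supp_in b l' u'" "b $$ u' \<noteq> 0"
    and le: "u' - l' \<le> u - l"
  shows "\<exists>m\<in>laurent_polys. supp_in (a - b \<cdot> m) l (u - 1)"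
proof -
  define c where "c = qdil (q powi (- u')) (a $$ u / b $$ u')"
  have n: "(a - b \<cdot> mon c (u - u')) $$ n
      = a $$ n - b $$ (n - (u - u')) * qdil (q powi (n - (u - u'))) c" for n
    by (simp add: mul_mon_nth)
  have "(a - b \<cdot> mon c (u - u')) $$ u = 0"
  proof -
    have "qdil (q powi u') c = a $$ u / b $$ u'"
      unfolding c_def qdil_simps by simp
    then show ?thesis unfolding n using b(2) by simp
  qed
  moreover have "(a - b \<cdot> mon c (u - u')) $$ i = 0" if "i < l \<or> i > u" for i
  proof -
    have "a $$ i = 0" using that a by (force simp: supp_in_def)
    moreover have "b $$ (i - (u - u')) = 0"
      using that b(1) le unfolding supp_in_def by (smt (verit))
    ultimately show ?thesis unfolding n by simp
  qed
  ultimately have "supp_in (a - b \<cdot> mon c (u - u')) l (u - 1)"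
    unfolding supp_in_def by (smt (verit))
  then show ?thesis by blast
qed

text \<open>
  Common right multiples come from the Euclidean algorithm: cancelling leading terms shortens one of the
  two supports, and a relation for \<open>a - b m\<close> and \<open>b\<close> yields one for \<open>a\<close> and \<open>b\<close>.
\<close>

lemma ore_aux:
  assumes "supp_in a l u" "supp_in b l' u'"
  shows "\<exists>s\<in>laurent_polys. \<exists>t\<in>laurent_polys. (s \<noteq> 0 \<or> t \<noteq> 0) \<and> a \<cdot> s = b \<cdot> t"
  using assms
proof (induction "nat (u - l + 1) + nat (u' - l' + 1)" arbitrary: a b l u l' u' rule: less_induct)
  case less
  have lu: "l \<le> u" if "a \<noteq> 0"
    using that less.prems(1) unfolding supp_in_def fls_eq_iff by force
  have lu': "l' \<le> u'" if "b \<noteq> 0"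
    using that less.prems(2) unfolding supp_in_def fls_eq_iff by force
  consider "a = 0" | "b = 0" | "a \<noteq> 0" "b \<noteq> 0" "a $$ u = 0" | "a \<noteq> 0" "b \<noteq> 0" "b $$ u' = 0"
    | "a \<noteq> 0" "b \<noteq> 0" "a $$ u \<noteq> 0" "b $$ u' \<noteq> 0" "u' - l' \<le> u - l"
    | "a \<noteq> 0" "b \<noteq> 0" "a $$ u \<noteq> 0" "b $$ u' \<noteq> 0" "u - l \<le> u' - l'"
    using linear[of "u' - l'" "u - l"] by blast
  then show ?case
  proof cases
    case 1
    then show ?thesis by (intro bexI[of _ 1] bexI[of _ 0]) auto
  next
    case 2
    then show ?thesis by (intro bexI[of _ 1] bexI[of _ 0]) auto
  next
    case 3
    then have "supp_in a l (u - 1)"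
      using less.prems(1) unfolding supp_in_def by (metis zle_diff1_eq order_le_less)
    moreover have "nat (u - 1 - l + 1) + nat (u' - l' + 1) < nat (u - l + 1) + nat (u' - l' + 1)"
      using lu 3 by auto
    ultimately show ?thesis by (intro less.hyps[OF _ _ less.prems(2)])
  next
    case 4
    then have "supp_in b l' (u' - 1)"
      using less.prems(2) unfolding supp_in_def by (metis zle_diff1_eq order_le_less)
    moreover have "nat (u - l + 1) + nat (u' - 1 - l' + 1) < nat (u - l + 1) + nat (u' - l' + 1)"
      using lu' 4 by auto
    ultimately show ?thesis by (intro less.hyps[OF _ less.prems(1)])
  next
    case 5
    then obtain m where m: "m \<in> laurent_polys" "supp_in (a - b \<cdot> m) l (u - 1)"
      using cancel_top less.prems by blast
    moreover have "nat (u - 1 - l + 1) + nat (u' - l' + 1) < nat (u - l + 1) + nat (u' - l' + 1)"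
      using lu 5 by auto
    ultimately obtain s t where st: "s \<in> laurent_polys" "t \<in> laurent_polys" "s \<noteq> 0 \<or> t \<noteq> 0" "(a - b \<cdot> m) \<cdot> s = b \<cdot> t"
      using less.hyps[OF _ _ less.prems(2)] by metis
    then have "a \<cdot> s = b \<cdot> (t + m \<cdot> s)" by (simp add: distribs assoc algebra_simps)
    then show ?thesis
      using st m by (intro bexI[of _ s] bexI[of _ "t + m \<cdot> s"]) auto
  next
    case 6
    then obtain m where m: "m \<in> laurent_polys" "supp_in (b - a \<cdot> m) l' (u' - 1)"
      using cancel_top less.prems by blast
    moreover have "nat (u - l + 1) + nat (u' - 1 - l' + 1) < nat (u - l + 1) + nat (u' - l' + 1)"
      using lu' 6 by auto
    ultimately obtain s t where st: "s \<in> laurent_polys" "t \<in> laurent_polys" "s \<noteq> 0 \<or> t \<noteq> 0" "a \<cdot> s = (b - a \<cdot> m) \<cdot> t"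
      using less.hyps[OF _ less.prems(1)] by metis
    then have "a \<cdot> (s + m \<cdot> t) = b \<cdot> t" by (simp add: distribs assoc algebra_simps)
    then show ?thesis
      using st m by (intro bexI[of _ t] bexI[of _ "s + m \<cdot> t"]) auto
  qed
qed

lemma ore:
  assumes "a \<in> laurent_polys" "b \<in> laurent_polys" "a \<noteq> 0" "b \<noteq> 0"
  obtains s t where "s \<in> laurent_polys" "t \<in> laurent_polys" "s \<noteq> 0" "t \<noteq> 0" "a \<cdot> s = b \<cdot> t"
proof -
  have "\<exists>u. supp_in f (fls_subdegree f) u" if "f \<in> laurent_polys" for f
    using that unfolding supp_in_def laurent_polys_def by (simp, metis not_less fls_subdegree_leI)
  then obtain u u' where "supp_in a (fls_subdegree a) u" "supp_in b (fls_subdegree b) u'"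
    using assms by metis
  from ore_aux[OF this] show ?thesis using that assms by (metis mul_eq_0_iff)
qed

section \<open>The division ring of fractions\<close>

text \<open>
  Being a division subring of \<open>L\<close> that contains \<open>k\<close>.  Negatives, \<open>0\<close> and \<open>1\<close> come from the scalars.
\<close>

definition skew_field :: "'a poly fract fls set \<Rightarrow> bool" where
  "skew_field V \<longleftrightarrow> (\<forall>c. qscal c \<in> V) \<and> (\<forall>f\<in>V. \<forall>g\<in>V. f + g \<in> V \<and> f \<cdot> g \<in> V)
     \<and> (\<forall>f\<in>V. f \<noteq> 0 \<longrightarrow> iv f \<in> V)"

lemma qscal_simps: "qscal 0 = (0 :: 'a poly fract fls)" "qscal 1 = (1 :: 'a poly fract fls)" "qscal (- c) = - qscal (c :: 'a)"
  "qscal (c * d) = qscal c \<cdot> qscal d" "qscal (c + d) = qscal c + qscal d"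
  by (auto simp: mon_simps mon_mul_mon cst_simps fls_eq_iff mon_nth)

lemma qscal_commute: "f \<cdot> qscal c = qscal c \<cdot> f"
  by (rule fls_eqI) (simp add: mon_simps mon_mul_nth mul_mon_nth)

context
  fixes V assumes V: "skew_field V"
begin

lemma
  shows skew_field_scal: "qscal c \<in> V"
    and skew_field_add: "f \<in> V \<Longrightarrow> g \<in> V \<Longrightarrow> f + g \<in> V"
    and skew_field_mul: "f \<in> V \<Longrightarrow> g \<in> V \<Longrightarrow> f \<cdot> g \<in> V"
    and skew_field_iv: "f \<in> V \<Longrightarrow> f \<noteq> 0 \<Longrightarrow> iv f \<in> V"
  using V by (auto simp: skew_field_def)

lemma skew_field_0: "0 \<in> V" and skew_field_1: "1 \<in> V"
  using skew_field_scal[of 0] skew_field_scal[of 1] by (simp_all add: qscal_simps)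

lemma skew_field_minus: "f \<in> V \<Longrightarrow> - f \<in> V"
  using skew_field_mul[OF skew_field_scal[of "- 1"], of f] by (simp add: qscal_simps minus_left)

lemma skew_field_diff: "f \<in> V \<Longrightarrow> g \<in> V \<Longrightarrow> f - g \<in> V"
  using skew_field_add[of f "- g"] skew_field_minus[of g] by simp

lemmas skew_field_intros = skew_field_0 skew_field_1 skew_field_scal skew_field_add skew_field_mul
  skew_field_minus skew_field_diff skew_field_iv

end

text \<open>
  Fractions are added and multiplied over common right multiples of their denominators.
\<close>

lemma skew_field_fractions: "skew_field {f. \<exists>Q\<in>laurent_polys. Q \<noteq> 0 \<and> f \<cdot> Q \<in> laurent_polys}"
  unfolding skew_field_def mem_Collect_eq
proof (intro conjI allI ballI impI; (unfold mem_Collect_eq)?)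
  show "\<exists>Q\<in>laurent_polys. Q \<noteq> 0 \<and> qscal c \<cdot> Q \<in> laurent_polys" for c
    by (intro bexI[of _ 1]) (auto simp: mon_simps(1))
next
  fix f g
  assume "\<exists>Q\<in>laurent_polys. Q \<noteq> 0 \<and> f \<cdot> Q \<in> laurent_polys" "\<exists>Q\<in>laurent_polys. Q \<noteq> 0 \<and> g \<cdot> Q \<in> laurent_polys"
  then obtain Q Q' where Q: "Q \<in> laurent_polys" "Q' \<in> laurent_polys" "Q \<noteq> 0" "Q' \<noteq> 0" "f \<cdot> Q \<in> laurent_polys" "g \<cdot> Q' \<in> laurent_polys"
    by blast
  obtain s t where st: "s \<in> laurent_polys" "t \<in> laurent_polys" "s \<noteq> 0" "t \<noteq> 0" "Q \<cdot> s = Q' \<cdot> t"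
    using ore Q by blast
  have "(f + g) \<cdot> (Q \<cdot> s) = f \<cdot> Q \<cdot> s + g \<cdot> Q' \<cdot> t"
    using st(5) by (simp add: distribs assoc)
  then show "\<exists>Q\<in>laurent_polys. Q \<noteq> 0 \<and> (f + g) \<cdot> Q \<in> laurent_polys"
    using Q st by (intro bexI[of _ "Q \<cdot> s"]) auto
  show "\<exists>Q\<in>laurent_polys. Q \<noteq> 0 \<and> f \<cdot> g \<cdot> Q \<in> laurent_polys"
  proof (cases "g = 0")
    case False
    then obtain s t where st: "s \<in> laurent_polys" "t \<in> laurent_polys" "s \<noteq> 0" "t \<noteq> 0" "g \<cdot> Q' \<cdot> s = Q \<cdot> t"
      using ore[of "g \<cdot> Q'" Q] Q by auto
    have "f \<cdot> g \<cdot> (Q' \<cdot> s) = f \<cdot> Q \<cdot> t"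
      using st(5) by (simp add: assoc)
    then show ?thesis
      using Q st by (intro bexI[of _ "Q' \<cdot> s"]) auto
  qed (intro bexI[of _ 1], auto)
next
  fix f :: "'a poly fract fls"
  assume f: "\<exists>Q\<in>laurent_polys. Q \<noteq> 0 \<and> f \<cdot> Q \<in> laurent_polys" "f \<noteq> 0"
  then obtain Q where "Q \<in> laurent_polys" "Q \<noteq> 0" "f \<cdot> Q \<in> laurent_polys" by blast
  then show "\<exists>Q\<in>laurent_polys. Q \<noteq> 0 \<and> iv f \<cdot> Q \<in> laurent_polys"
    using f by (intro bexI[of _ "f \<cdot> Q"]) auto
qed

lemma a_inv_qLaurent: "a_inv (qLaurent q) f = - f"
proof -
  interpret R: ring "qLaurent q" by (rule ring_qLaurent[OF q_nz])
  show ?thesis by (rule R.minus_equality) auto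
qed

lemma qplane_closed: "qscal c \<in> qplane q" "qx \<in> qplane q" "qy \<in> qplane q"
    "f \<in> qplane q \<Longrightarrow> g \<in> qplane q \<Longrightarrow> f + g \<in> qplane q"
    "f \<in> qplane q \<Longrightarrow> g \<in> qplane q \<Longrightarrow> f \<cdot> g \<in> qplane q"
  using generate_ring.eng_add[of f "qLaurent q" _ g] generate_ring.eng_mult[of f "qLaurent q" _ g]
  unfolding qplane_def by (auto intro: generate_ring.incl)

lemma qplane_minimal:
  assumes "\<And>c. qscal c \<in> V" "qx \<in> V" "qy \<in> V" "\<And>f g. f \<in> V \<Longrightarrow> g \<in> V \<Longrightarrow> f + g \<in> V"
    "\<And>f g. f \<in> V \<Longrightarrow> g \<in> V \<Longrightarrow> f \<cdot> g \<in> V"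
  shows "qplane q \<subseteq> V"
proof
  fix f assume "f \<in> qplane q"
  then show "f \<in> V"
    unfolding qplane_def
  proof (induction rule: generate_ring.induct)
    case one
    then show ?case using assms(1)[of 1] by (simp add: qscal_simps)
  next
    case (a_inv h)
    then show ?case
      using assms(5)[OF assms(1)[of "- 1"], of h] assms
      by (auto simp: a_inv_qLaurent qscal_simps minus_left)
  qed (use assms in auto)
qed

definition is_polynomial :: "'a poly fract \<Rightarrow> bool" where "is_polynomial a \<longleftrightarrow> (\<exists>p. a = Fract p 1)"

lemma is_polynomial_0: "is_polynomial 0"
  by (auto simp: is_polynomial_def Zero_fract_def)

lemma is_polynomial_mult: "is_polynomial a \<Longrightarrow> is_polynomial b \<Longrightarrow> is_polynomial (a * b)"
  by (auto simp: is_polynomial_def)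

lemma polynomial_mem:
  assumes "\<And>c. qscal c \<in> V" "qy \<in> V" "\<And>f g. f \<in> V \<Longrightarrow> g \<in> V \<Longrightarrow> f + g \<in> V"
    "\<And>f g. f \<in> V \<Longrightarrow> g \<in> V \<Longrightarrow> f \<cdot> g \<in> V"
  shows "mon (Fract p 1) 0 \<in> V"
proof (induction p)
  case 0
  then show ?case using assms(1)[of 0] by (simp add: mon_simps cst_def)
next
  case (pCons c p)
  have "Fract (pCons c p) 1 = cst c + yc * Fract p 1"
    by (simp add: cst_def yc_def)
  then have "mon (Fract (pCons c p) 1) 0 = qscal c + qy \<cdot> mon (Fract p 1) 0"
    by (auto simp: mon_simps mon_mul_mon fls_eq_iff mon_nth)
  then show ?case using pCons assms by simp
qed

lemma qplane_const: "is_polynomial a \<Longrightarrow> mon a 0 \<in> qplane q"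
  unfolding is_polynomial_def by (auto intro!: polynomial_mem qplane_closed)

lemma qplane_mon:
  assumes "is_polynomial a"
  shows "mon a (int n) \<in> qplane q"
proof (induction n)
  case 0
  then show ?case using qplane_const[OF assms] by simp
next
  case (Suc n)
  have "mon a (int (Suc n)) = mon a (int n) \<cdot> qx"
    using qdil_simps(1)[of "int n"] by (simp add: mon_simps mon_mul_mon add.commute)
  then show ?case using Suc qplane_closed by simp
qed

lemma is_polynomial_in_qplane:
  assumes "supp_in f 0 (int n)" "\<And>i. is_polynomial (f $$ i)"
  shows "f \<in> qplane q"
  using assms
proof (induction n arbitrary: f)
  case 0
  then have "f = mon (f $$ 0) 0" by (auto simp: fls_eq_iff mon_nth supp_in_def)
  then show ?case using qplane_const 0 by metis
next
  case (Suc n)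
  let ?t = "mon (f $$ int (Suc n)) (int (Suc n))"
  have "supp_in (f - ?t) 0 (int n)"
    using Suc.prems(1) unfolding supp_in_def by (force simp: mon_nth split: if_splits)
  moreover have "is_polynomial ((f - ?t) $$ i)" for i
    using Suc.prems(2)[of i] is_polynomial_0 by (auto simp: mon_nth)
  ultimately have "f - ?t \<in> qplane q" by (rule Suc.IH)
  moreover have "?t \<in> qplane q" by (rule qplane_mon[OF Suc.prems(2)])
  ultimately have "(f - ?t) + ?t \<in> qplane q" by (rule qplane_closed)
  then show ?case by simp
qed

text \<open>
  Moving a factor \<open>c\<close> from the right past \<open>x\<^sup>j\<close> turns it into \<open>c(q\<^sup>j y)\<close>, so the denominator of the
  coefficient at \<open>j\<close> is cleared by a factor dilated by \<open>q\<^sup>-\<^sup>j\<close>.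
\<close>

lemma common_denominator:
  assumes "finite J"
  shows "\<exists>c. is_polynomial c \<and> c \<noteq> 0 \<and> (\<forall>(j, a)\<in>J. is_polynomial (a * qdil (q powi j) c))"
  using assms
proof (induction J)
  case empty
  have "is_polynomial 1" by (auto simp: is_polynomial_def One_fract_def)
  then show ?case by (intro exI[of _ 1]) auto
next
  case (insert ja J)
  then obtain c where c: "is_polynomial c" "c \<noteq> 0" "\<forall>(j, a)\<in>J. is_polynomial (a * qdil (q powi j) c)" by blast
  obtain j a where ja: "ja = (j, a)" by fastforce
  obtain n d where a: "a = Fract n d" "d \<noteq> 0" by (cases a) auto
  define e where "e = qdil (q powi (- j)) (Fract d 1)"
  have is_polynomial_qdil: "is_polynomial (qdil (q powi i) b)" if "is_polynomial b" for i b
    using that q_nz by (auto simp: is_polynomial_def qdil_Fract pcompose_1)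
  have d: "is_polynomial (Fract d 1)" by (auto simp: is_polynomial_def)
  then have e: "is_polynomial e" unfolding e_def by (rule is_polynomial_qdil)
  have "is_polynomial (a * qdil (q powi j) (c * e))"
  proof -
    have "qdil (q powi j) e = Fract d 1" unfolding e_def qdil_simps by simp
    then have "a * qdil (q powi j) (c * e) = (a * Fract d 1) * qdil (q powi j) c"
      by simp
    moreover have "is_polynomial (a * Fract d 1)"
      using a unfolding is_polynomial_def by (intro exI[of _ n]) (simp add: eq_fract)
    ultimately show ?thesis using c is_polynomial_qdil is_polynomial_mult by metis
  qed
  moreover have "is_polynomial (b * qdil (q powi i) (c * e))" if "(i, b) \<in> J" for i b
    using c(3) that is_polynomial_mult[of "b * qdil (q powi i) c" "qdil (q powi i) e"] is_polynomial_qdil[OF e]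
    by (auto simp: mult.assoc)
  moreover have "is_polynomial (c * e)" using c e is_polynomial_mult by blast
  moreover have "Fract d 1 \<noteq> 0" using a by (simp add: Zero_fract_def eq_fract)
  then have "c * e \<noteq> 0" using c by (simp add: e_def)
  ultimately show ?case unfolding ja by (intro exI[of _ "c * e"]) auto
qed

lemma laurent_polys_clear_denominators:
  assumes "P \<in> laurent_polys" "Q \<in> laurent_polys"
  obtains d where "d \<noteq> 0" "P \<cdot> d \<in> qplane q" "Q \<cdot> d \<in> qplane q"
proof -
  define I where "I = {i. P $$ i \<noteq> 0} \<union> {i. Q $$ i \<noteq> 0}"
  have I: "finite I" using assms by (simp add: I_def laurent_polys_finite_support)
  define J where "J = (\<lambda>i. (i, P $$ i)) ` I \<union> (\<lambda>i. (i, Q $$ i)) ` I"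
  have "finite J" using I by (simp add: J_def)
  then obtain c where c: "c \<noteq> 0" "\<forall>(j, a)\<in>J. is_polynomial (a * qdil (q powi j) c)"
    using common_denominator by blast
  define N where "N = Max (insert 0 (abs ` I))"
  have N: "\<bar>i\<bar> \<le> N" if "i \<in> I" for i
    unfolding N_def using that I by (intro Max_ge) auto
  have "F \<cdot> mon c N \<in> qplane q" if F: "F = P \<or> F = Q" for F
  proof (rule is_polynomial_in_qplane)
    show "supp_in (F \<cdot> mon c N) 0 (int (nat (2 * N)))"
      unfolding supp_in_def
    proof (intro allI impI)
      fix i assume "(F \<cdot> mon c N) $$ i \<noteq> 0"
      then have "i - N \<in> I" using F by (auto simp: mul_mon_nth I_def)
      then show "0 \<le> i \<and> i \<le> int (nat (2 * N))" using N[of "i - N"] by auto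
    qed
    show "is_polynomial ((F \<cdot> mon c N) $$ i)" for i
    proof (cases "i - N \<in> I")
      case True
      then have "(i - N, F $$ (i - N)) \<in> J" using F by (auto simp: J_def)
      then show ?thesis using c by (auto simp: mul_mon_nth)
    next
      case False
      then have "(F \<cdot> mon c N) $$ i = 0" using F by (auto simp: mul_mon_nth I_def)
      then show ?thesis by (auto simp: is_polynomial_def Zero_fract_def)
    qed
  qed
  then show ?thesis using c by (intro that[of "mon c N"]) auto
qed

text \<open>
  Numerators and denominators may be taken among the skew Laurent polynomials, where the Ore condition is
  at hand: a common denominator and a power of \<open>x\<close>, multiplied from the right, lead back to the quantum
  plane.
\<close>

lemma qdiv_eq: "qdiv q = {f. \<exists>Q\<in>laurent_polys. Q \<noteq> 0 \<and> f \<cdot> Q \<in> laurent_polys}"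
proof (intro Set.set_eqI iffI)
  fix f assume "f \<in> qdiv q"
  then obtain a b where ab: "f = a \<cdot> iv b" "a \<in> qplane q" "b \<in> qplane q" "b \<noteq> 0"
    by (auto simp: qdiv_def)
  have "qplane q \<subseteq> laurent_polys" by (rule qplane_minimal) (auto simp: mon_simps)
  then show "f \<in> {f. \<exists>Q\<in>laurent_polys. Q \<noteq> 0 \<and> f \<cdot> Q \<in> laurent_polys}"
    using ab by (intro CollectI bexI[of _ b]) (auto simp: assoc)
next
  fix f assume "f \<in> {f. \<exists>Q\<in>laurent_polys. Q \<noteq> 0 \<and> f \<cdot> Q \<in> laurent_polys}"
  then obtain Q where Q: "Q \<in> laurent_polys" "Q \<noteq> 0" "f \<cdot> Q \<in> laurent_polys" by blast
  then obtain d where d: "d \<noteq> 0" "f \<cdot> Q \<cdot> d \<in> qplane q" "Q \<cdot> d \<in> qplane q"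
    using laurent_polys_clear_denominators by blast
  have "f = (f \<cdot> Q \<cdot> d) \<cdot> iv (Q \<cdot> d)"
    using Q d iv_right[of "Q \<cdot> d"] by (simp add: assoc del: iv_right)
  then show "f \<in> qdiv q"
    using Q(2) d unfolding qdiv_def qLaurent_simps
    by (intro CollectI exI[of _ "f \<cdot> Q \<cdot> d"] exI[of _ "Q \<cdot> d"]) auto
qed

lemma skew_field_qdiv: "skew_field (qdiv q)"
  unfolding qdiv_eq by (rule skew_field_fractions)

lemma laurent_polys_subset_qdiv: "laurent_polys \<subseteq> qdiv q"
  unfolding qdiv_eq by (auto intro!: bexI[of _ 1])

text \<open>
  This reduces every inclusion of the form \<open>c\<^sub>z(D) \<subseteq> V\<close> to the images of \<open>x\<close> and \<open>y\<close>.
\<close>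

lemma qdiv_minimal:
  assumes V: "skew_field V" "qx \<in> V" "qy \<in> V"
  shows "qdiv q \<subseteq> V"
proof
  fix f assume "f \<in> qdiv q"
  then obtain a b where "f = a \<cdot> iv b" "a \<in> qplane q" "b \<in> qplane q" "b \<noteq> 0"
    by (auto simp: qdiv_def)
  moreover have "qplane q \<subseteq> V"
    by (rule qplane_minimal) (auto intro: skew_field_intros V)
  ultimately show "f \<in> V" using V(1) by (auto intro: skew_field_intros)
qed

section \<open>Conjugations attached to q-commuting pairs\<close>

definition cj :: "'a poly fract fls \<Rightarrow> 'a poly fract fls \<Rightarrow> 'a poly fract fls" where
  "cj z f = z \<cdot> f \<cdot> iv z"

lemma qconj_eq: "qconj q z = cj z"
  by (simp add: fun_eq_iff qconj_def cj_def)

lemma cj_eqI: "z \<noteq> 0 \<Longrightarrow> z \<cdot> f = g \<cdot> z \<Longrightarrow> cj z f = g"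
  by (simp add: cj_def assoc)

lemma cj_swap: "z \<noteq> 0 \<Longrightarrow> z \<cdot> f = cj z f \<cdot> z"
  by (simp add: cj_def assoc)

lemma cj_add: "cj z (f + g) = cj z f + cj z g"
  by (simp add: cj_def distribs)

lemma cj_mul: "z \<noteq> 0 \<Longrightarrow> cj z (f \<cdot> g) = cj z f \<cdot> cj z g"
  by (simp add: cj_def assoc)

lemma cj_qscal: "z \<noteq> 0 \<Longrightarrow> cj z (qscal c) = qscal c"
  by (rule cj_eqI) (auto simp: qscal_commute)

lemma cj_1: "z \<noteq> 0 \<Longrightarrow> cj z 1 = 1"
  by (rule cj_eqI) auto

lemma cj_0_iff: "z \<noteq> 0 \<Longrightarrow> cj z f = 0 \<longleftrightarrow> f = 0"
  by (simp add: cj_def)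

lemma cj_iv: "z \<noteq> 0 \<Longrightarrow> f \<noteq> 0 \<Longrightarrow> cj z (iv f) = iv (cj z f)"
  by (simp add: cj_def iv_mul assoc)

lemma cj_iv_cj [simp]: "z \<noteq> 0 \<Longrightarrow> cj (iv z) (cj z f) = f"
  and cj_cj_iv [simp]: "z \<noteq> 0 \<Longrightarrow> cj z (cj (iv z) f) = f"
  by (simp_all add: cj_def assoc)

lemma skew_field_vimage:
  assumes "skew_field V" "z \<noteq> 0"
  shows "skew_field (cj z -` V)"
  unfolding skew_field_def using assms
  by (auto simp: cj_qscal cj_add cj_mul cj_iv cj_0_iff intro: skew_field_intros)

lemma bij_betw_cj:
  assumes "z \<noteq> 0" "cj z ` V \<subseteq> V" "cj (iv z) ` V \<subseteq> V"
  shows "bij_betw (cj z) V V"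
  using assms by (intro bij_betw_byWitness[where f' = "cj (iv z)"]) auto

lemma skew_field_const:
  assumes V: "skew_field V" and y: "qy \<in> V"
  shows "mon a 0 \<in> V"
proof -
  have poly: "mon (Fract p 1) 0 \<in> V" for p
    using y by (auto intro!: polynomial_mem intro: skew_field_intros V)
  obtain n d where a: "a = Fract n d" "d \<noteq> 0" by (cases a) auto
  have d: "Fract d 1 \<noteq> 0" using a by (simp add: Zero_fract_def eq_fract)
  have "a * Fract d 1 = Fract n 1" using a by (simp add: eq_fract)
  then have "mon a 0 \<cdot> mon (Fract d 1) 0 = mon (Fract n 1) 0"
    using qdil_simps(1)[of 0] by (simp add: mon_mul_mon)
  then have "mon a 0 = mon (Fract n 1) 0 \<cdot> iv (mon (Fract d 1) 0)"
    using d by (metis assoc iv_right mon_eq_0_iff one_right)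
  then show ?thesis
    using skew_field_mul[OF V poly skew_field_iv[OF V poly]] d by simp
qed

text \<open>
  The coefficient of \<open>x\<^sup>n\<close> in \<open>z y = Y z\<close> reads \<open>(q\<^sup>n - 1) y z\<^sub>n = \<dots>\<close>, with only \<open>z\<^sub>j\<close> for \<open>j < n\<close> on the
  right.  As \<open>q\<close> is not a root of unity, this is a recursion for \<open>z\<close> once \<open>z\<^sub>0 = 1\<close> is chosen.
\<close>

lemma conj_from_leading_term:
  assumes Y: "\<And>i. i < 0 \<Longrightarrow> Y $$ i = 0" "Y $$ 0 = yc"
  obtains z where "z $$ 0 = 1" "z \<cdot> qy = Y \<cdot> z" "\<And>i. i < 0 \<Longrightarrow> z $$ i = 0"
proof -
  define step where "step h n = (if n = 0 then 1 else
      (\<Sum>j<n. Y $$ int (n - j) * qdil (q powi int (n - j)) (h j)) / (yc * (cst (q ^ n) - 1)))"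
    for h :: "nat \<Rightarrow> 'a poly fract" and n
  define h where "h = wfrec less_than (\<lambda>h n. step h n)"
  have h: "h n = step h n" for n
  proof -
    have "h n = step (cut h less_than n) n"
      unfolding h_def by (subst wfrec[OF wf_less_than]) simp
    also have "\<dots> = step h n"
      by (simp add: step_def cut_def)
    finally show ?thesis .
  qed
  define z where "z = Abs_fls (\<lambda>n. if n < 0 then 0 else h (nat n))"
  have zn: "z $$ n = (if n < 0 then 0 else h (nat n))" for n
    unfolding z_def by (subst nth_Abs_fls_lower_bound[of 0]) auto
  have "(z \<cdot> qy) $$ n = (Y \<cdot> z) $$ n" for n
  proof (cases "n < 0")
    case True
    have "(Y \<cdot> z) $$ n = (\<Sum>i\<in>{}. Y $$ i * qdil (q powi i) (z $$ (n - i)))"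
    proof (rule skew_mult_nth')
      fix i assume "Y $$ i \<noteq> 0" "z $$ (n - i) \<noteq> 0"
      then show "i \<in> {}" using True Y(1)[of i] by (auto simp: zn split: if_splits)
    qed simp
    then show ?thesis using True by (simp add: mon_simps mul_mon_nth zn)
  next
    case False
    define N where "N = nat n"
    have n: "n = int N" using False by (simp add: N_def)
    have "(Y \<cdot> z) $$ n = (\<Sum>i = 0..n. Y $$ i * qdil (q powi i) (z $$ (n - i)))"
    proof (rule skew_mult_nth')
      fix i assume "Y $$ i \<noteq> 0" "z $$ (n - i) \<noteq> 0"
      then show "i \<in> {0..n}" using Y(1)[of i] by (force simp: zn split: if_splits)
    qed simp
    also have "\<dots> = (\<Sum>j\<le>N. Y $$ int (N - j) * qdil (q powi int (N - j)) (h j))"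
      by (rule sum.reindex_bij_witness[of _ "\<lambda>j. int (N - j)" "\<lambda>i. nat (n - i)"])
        (auto simp: n zn simp del: power_int_of_nat)
    also have "\<dots> = (\<Sum>j<N. Y $$ int (N - j) * qdil (q powi int (N - j)) (h j)) + yc * h N"
      using Y(2) by (simp flip: lessThan_Suc_atMost)
    also have "\<dots> = h N * (cst (q ^ N) * yc)"
    proof (cases "N = 0")
      case True
      then show ?thesis by (simp add: cst_simps)
    next
      case False
      then have "cst (q ^ N) - 1 \<noteq> 0"
        using q_pow[of N] by (simp flip: cst_simps(2))
      then have "(\<Sum>j<N. Y $$ int (N - j) * qdil (q powi int (N - j)) (h j))
          = h N * (yc * (cst (q ^ N) - 1))"
        using False by (subst (2) h) (simp add: step_def)
      then show ?thesis by (simp add: algebra_simps)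
    qed
    also have "\<dots> = (z \<cdot> qy) $$ n"
      using qdil_yc[of "int N"] by (simp add: mon_simps mul_mon_nth zn n)
    finally show ?thesis by simp
  qed
  then have "z \<cdot> qy = Y \<cdot> z" by (rule fls_eqI)
  moreover have "z $$ 0 = 1" by (simp add: zn h[of 0] step_def)
  ultimately show ?thesis by (intro that[of z]) (simp_all add: zn)
qed

text \<open>
  In \<open>u y = q y u\<close> the coefficient of \<open>x\<^sup>n\<close> is multiplied by \<open>q\<^sup>n\<close> on the left and by \<open>q\<close> on the right,
  which leaves only \<open>n = 1\<close>.
\<close>

lemma q_commuting_with_y:
  assumes "u \<cdot> qy = qscal q \<cdot> qy \<cdot> u"
  shows "u = mon (u $$ 1) 1"
proof (rule fls_eqI)
  fix n
  have "u $$ n * (cst (q powi n) * yc) = cst q * yc * u $$ n"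
    using arg_cong[OF assms, of "\<lambda>f. f $$ n"]
    by (simp add: mon_simps mul_mon_nth mon_mul_nth mon_mul_mon)
  then have "u $$ n * yc * (cst (q powi n) - cst q) = 0" by (simp add: algebra_simps)
  moreover have "q powi n \<noteq> q" if "n \<noteq> 1"
  proof
    assume "q powi n = q"
    then have "q powi (n - 1) = 1" using q_nz by (simp add: power_int_diff)
    then show False using that by (simp add: q_powi_eq_1_iff)
  qed
  ultimately show "u $$ n = mon (u $$ 1) 1 $$ n" by (auto simp: mon_nth)
qed

text \<open>
  The source of all examples.  The element \<open>u\<close> is \<open>c\<^sub>z(a(y) x)\<close> rather than \<open>c\<^sub>z(x)\<close>, but a division ring
  that contains \<open>Y = c\<^sub>z(y)\<close> also contains \<open>c\<^sub>z(a(y))\<close>.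
\<close>

lemma q_pair_conj:
  assumes Y: "\<And>i. i < 0 \<Longrightarrow> Y $$ i = 0" "Y $$ 0 = yc"
    and u: "u \<noteq> 0" "u \<cdot> Y = qscal q \<cdot> Y \<cdot> u"
  obtains z a where "z $$ 0 = 1" "z \<noteq> 0" "a \<noteq> 0" "\<And>i. i < 0 \<Longrightarrow> z $$ i = 0"
    "cj z qy = Y" "cj z (mon a 1) = u"
    "\<And>V. skew_field V \<Longrightarrow> Y \<in> V \<Longrightarrow> u \<in> V \<Longrightarrow> cj z ` qdiv q \<subseteq> V"
proof -
  obtain z where z: "z $$ 0 = 1" "z \<cdot> qy = Y \<cdot> z" "\<And>i. i < 0 \<Longrightarrow> z $$ i = 0"
    using conj_from_leading_term[OF Y] by blast
  have z0: "z \<noteq> 0" using z(1) by auto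
  have zy: "cj z qy = Y" using z z0 by (intro cj_eqI)
  define v where "v = cj (iv z) u"
  have "cj z (v \<cdot> qy) = cj z (qscal q \<cdot> qy \<cdot> v)"
    using z0 u(2) zy by (simp add: v_def cj_mul cj_qscal)
  then have "v \<cdot> qy = qscal q \<cdot> qy \<cdot> v" using z0 by (metis cj_iv_cj)
  then obtain a where a: "v = mon a 1" using q_commuting_with_y by blast
  have zu: "cj z (mon a 1) = u" using z0 by (simp add: v_def flip: a)
  have a0: "a \<noteq> 0" using zu u(1) z0 by (auto simp: cj_0_iff)
  have "cj z ` qdiv q \<subseteq> V" if V: "skew_field V" "Y \<in> V" "u \<in> V" for V
  proof -
    have V': "skew_field (cj z -` V)" by (rule skew_field_vimage[OF V(1) z0])
    have y: "qy \<in> cj z -` V" using V zy by simp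
    have "iv (mon a 0) \<cdot> mon a 1 = qx"
    proof -
      have "mon a 1 = mon a 0 \<cdot> qx" using qdil_simps(1)[of 0] by (simp add: mon_simps mon_mul_mon)
      then show ?thesis using a0 by simp
    qed
    moreover have "mon a 1 \<in> cj z -` V" using zu V by simp
    ultimately have "qx \<in> cj z -` V"
      using skew_field_const[OF V' y, of a] a0 V' by (metis mon_eq_0_iff skew_field_iv skew_field_mul)
    then have "qdiv q \<subseteq> cj z -` V" using V' y by (intro qdiv_minimal)
    then show ?thesis by auto
  qed
  then show ?thesis using that z z0 a0 zy zu by blast
qed

section \<open>A bijective conjugation with no power in D\<close>

text \<open>
  If \<open>F = a b\<^sup>-\<^sup>1\<close>, then \<open>deg a - deg b\<close> depends only on \<open>F\<close> and is additive on products.  Here it is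
  compared for \<open>F y\<close> and \<open>w y F\<close>, through a common right multiple \<open>b s = y b t\<close>: the latter forces
  \<open>deg s = deg t\<close>, and then \<open>a s = w y a t\<close> forces \<open>deg w = 0\<close>.
\<close>

lemma has_deg_of_twist:
  assumes F: "F \<in> qdiv q" "F \<noteq> 0" "F \<cdot> qy = w \<cdot> qy \<cdot> F" and w: "has_deg w n"
  shows "n = 0"
proof -
  obtain b where b: "b \<in> laurent_polys" "b \<noteq> 0" "F \<cdot> b \<in> laurent_polys" using F(1) by (auto simp: qdiv_eq)
  have y: "has_deg qy 0" by (simp add: has_deg_def mon_simps mon_nth)
  then have y0: "qy \<noteq> (0 :: 'a poly fract fls)" by (auto simp: has_deg_def)
  have "qy \<in> laurent_polys" by (simp add: mon_simps)
  then have "qy \<cdot> b \<in> laurent_polys" "qy \<cdot> b \<noteq> 0" using b y0 by auto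
  then obtain s t where st: "s \<in> laurent_polys" "t \<in> laurent_polys" "s \<noteq> 0" "t \<noteq> 0" "b \<cdot> s = qy \<cdot> b \<cdot> t"
    using ore[of b "qy \<cdot> b"] b by blast
  obtain i j k l where deg: "has_deg b i" "has_deg s j" "has_deg t k" "has_deg (F \<cdot> b) l"
    using b st F laurent_polys_has_deg by (metis mul_eq_0_iff)
  have "j = k"
    using has_deg_unique[OF has_deg_mul[OF deg(1,2)]]
      has_deg_mul[OF has_deg_mul[OF y deg(1)] deg(3)] st(5) by fastforce
  have "F \<cdot> b \<cdot> s = w \<cdot> qy \<cdot> (F \<cdot> b) \<cdot> t"
  proof -
    have "F \<cdot> b \<cdot> s = F \<cdot> qy \<cdot> b \<cdot> t" using st(5) by (simp add: assoc)
    then show ?thesis unfolding F(3) by (simp add: assoc)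
  qed
  then show ?thesis
    using has_deg_unique[OF has_deg_mul[OF deg(4,2)]] \<open>j = k\<close>
      has_deg_mul[OF has_deg_mul[OF has_deg_mul[OF w y] deg(4)] deg(3)] by fastforce
qed

text \<open>
  Here \<open>z\<close> is a \<open>q\<close>-exponential in \<open>x\<close>: it commutes with \<open>x\<close> and satisfies \<open>z y = (1 + x) y z\<close>.
\<close>

lemma ex_bijective_no_power:
  "\<exists>z. z \<notin> qdiv q \<and> z \<noteq> 0 \<and> bij_betw (cj z) (qdiv q) (qdiv q)
     \<and> (\<forall>n::nat. n \<ge> 1 \<longrightarrow> z [^]\<^bsub>qLaurent q\<^esub> n \<notin> qdiv q)"
proof -
  define p :: "'a poly fract fls" where "p = 1 + qx"
  define Y where "Y = p \<cdot> qy"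
  have p: "has_deg p 1" by (auto simp: has_deg_def p_def mon_simps mon_nth)
  then have p0: "p \<noteq> 0" by (auto simp: has_deg_def)
  have xp: "qx \<cdot> p = p \<cdot> qx" by (simp add: p_def distribs)
  have Yn: "Y $$ i = (if i = 0 then yc else if i = 1 then cst q * yc else 0)" for i
    using qdil_yc[of 1] by (simp add: Y_def p_def distribs mon_simps mon_mul_mon mon_nth)
  have xY: "qx \<cdot> Y = qscal q \<cdot> Y \<cdot> qx"
  proof -
    have "qx \<cdot> Y = p \<cdot> (qx \<cdot> qy)" unfolding Y_def by (simp add: assoc[symmetric] xp)
    also have "\<dots> = p \<cdot> qscal q \<cdot> qy \<cdot> qx" using qx_qy[OF q_nz] by (simp add: assoc)
    finally show ?thesis unfolding qscal_commute Y_def by (simp add: assoc)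
  qed
  have x0: "qx \<noteq> (0 :: 'a poly fract fls)" by (simp add: mon_simps)
  obtain z a where z: "z $$ 0 = 1" "z \<noteq> 0" "\<And>i. i < 0 \<Longrightarrow> z $$ i = 0"
    "cj z qy = Y" "cj z (mon a 1) = qx"
    and sub: "\<And>V. skew_field V \<Longrightarrow> Y \<in> V \<Longrightarrow> qx \<in> V \<Longrightarrow> cj z ` qdiv q \<subseteq> V"
    by (rule q_pair_conj[of Y qx]) (use Yn xY x0 in auto)
  have "z \<cdot> mon a 1 = qx \<cdot> z" using cj_swap[OF z(2), of "mon a 1"] z(5) by simp
  then have "(z \<cdot> mon a 1) $$ 1 = (qx \<cdot> z) $$ 1" by simp
  \<comment> \<open>The coefficient of \<open>x\<close>, where \<open>z\<close> contributes its constant term \<open>1\<close> on both sides.\<close>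
  then have "a = 1"
    using qdil_simps(1)[of 1] z(1) by (simp add: mon_simps(2) mul_mon_nth mon_mul_nth)
  then have zx: "cj z qx = qx" using z(5) by (simp add: mon_simps(2))
  have D: "skew_field (qdiv q)" by (rule skew_field_qdiv)
  have xyD: "qx \<in> qdiv q" "qy \<in> qdiv q" using laurent_polys_subset_qdiv by (auto simp: mon_simps)
  then have pD: "p \<in> qdiv q" "Y \<in> qdiv q" unfolding Y_def p_def by (auto intro: skew_field_intros D)
  have "cj z ` qdiv q \<subseteq> qdiv q" using sub D pD xyD by blast
  moreover have "cj (iv z) ` qdiv q \<subseteq> qdiv q"
  proof -
    have x': "cj (iv z) qx = qx" using zx z(2) by (metis cj_iv_cj)
    then have p': "cj (iv z) p = p" using z(2) by (simp add: p_def cj_add cj_1)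
    have "cj (iv z) Y = qy" using z by (metis cj_iv_cj)
    then have "p \<cdot> cj (iv z) qy = qy" using p' z(2) by (simp add: Y_def cj_mul)
    then have "cj (iv z) qy = iv p \<cdot> qy" using p0 by (metis iv_left_assoc)
    then have "cj (iv z) qy \<in> qdiv q" using pD xyD p0 by (auto intro: skew_field_intros D)
    then have "qdiv q \<subseteq> cj (iv z) -` qdiv q"
      using x' xyD z(2) by (intro qdiv_minimal skew_field_vimage D) auto
    then show ?thesis by auto
  qed
  ultimately have bij: "bij_betw (cj z) (qdiv q) (qdiv q)" using z(2) by (intro bij_betw_cj)
  have zx': "z \<cdot> qx = qx \<cdot> z" and zy': "z \<cdot> qy = p \<cdot> qy \<cdot> z"
    using cj_swap[OF z(2)] zx z(4) unfolding Y_def by metis+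
  define F where "F n = z [^]\<^bsub>qLaurent q\<^esub> n" for n :: nat
  have F0: "F 0 = 1" and FS: "F (Suc n) = F n \<cdot> z" for n by (simp_all add: F_def)
  have Fx: "F n \<cdot> qx = qx \<cdot> F n" for n
  proof (induction n)
    case (Suc n)
    then show ?case unfolding FS assoc zx' by (simp add: assoc[symmetric])
  qed (simp add: F0)
  have Fp: "F n \<cdot> p = p \<cdot> F n" for n by (simp add: p_def distribs Fx)
  have F_nz: "F n \<noteq> 0" for n by (induction n) (auto simp: F0 FS z(2))
  have "\<exists>w. has_deg w (int n) \<and> F n \<cdot> qy = w \<cdot> qy \<cdot> F n" for n
  proof (induction n)
    case 0
    have "has_deg 1 0" by (simp add: has_deg_def mon_simps mon_nth)
    then show ?case using F0 by (intro exI[of _ 1]) simp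
  next
    case (Suc n)
    then obtain w where w: "has_deg w (int n)" "F n \<cdot> qy = w \<cdot> qy \<cdot> F n" by blast
    have "F (Suc n) \<cdot> qy = p \<cdot> (F n \<cdot> qy) \<cdot> z"
      unfolding FS assoc zy' by (simp add: assoc[symmetric] Fp)
    also have "\<dots> = (p \<cdot> w) \<cdot> qy \<cdot> F (Suc n)" unfolding w FS by (simp add: assoc)
    finally show ?case using has_deg_mul[OF p w(1)] by (intro exI[of _ "p \<cdot> w"]) simp
  qed
  then have no_pow: "F n \<notin> qdiv q" if "n \<ge> 1" for n
    using has_deg_of_twist[of "F n"] F_nz that by (metis not_one_le_zero of_nat_eq_0_iff)
  have "z \<notin> qdiv q" using no_pow[of 1] FS[of 0] F0 by simp
  then show ?thesis using bij z(2) no_pow unfolding F_def by blast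
qed

section \<open>The involution inverting x and y\<close>

definition ev_inverse_y :: "'a poly \<Rightarrow> 'a poly fract" where
  "ev_inverse_y p = poly (map_poly cst p) (inverse yc)"

lemma ev_inverse_y_0 [simp]: "ev_inverse_y 0 = 0"
  by (simp add: ev_inverse_y_def)

lemma ev_inverse_y_pCons [simp]: "ev_inverse_y (pCons a p) = cst a + inverse yc * ev_inverse_y p"
  by (simp add: ev_inverse_y_def map_poly_pCons cst_simps)

lemma ev_inverse_y_add: "ev_inverse_y (p + r) = ev_inverse_y p + ev_inverse_y r"
  by (induction p r rule: poly_induct2) (simp_all add: cst_simps algebra_simps)

lemma ev_inverse_y_smult: "ev_inverse_y (smult a p) = cst a * ev_inverse_y p"
  by (induction p) (simp_all add: cst_simps algebra_simps)

lemma ev_inverse_y_mult: "ev_inverse_y (p * r) = ev_inverse_y p * ev_inverse_y r"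
  by (induction p) (simp_all add: ev_inverse_y_add ev_inverse_y_smult cst_simps algebra_simps)

lemma poly_map_cst: "poly (map_poly cst p) yc = Fract p 1"
proof (induction p)
  case 0
  then show ?case by (simp add: Zero_fract_def)
next
  case (pCons a p)
  then show ?case by (simp add: map_poly_pCons cst_simps) (simp add: cst_def yc_def)
qed

text \<open>
  \<open>p(y\<^sup>-\<^sup>1)\<close> is, up to a power of \<open>y\<close>, the reflected polynomial evaluated at \<open>y\<close>.
\<close>

lemma ev_inverse_y_eq_0_iff [simp]: "ev_inverse_y p = 0 \<longleftrightarrow> p = 0"
proof
  assume "ev_inverse_y p = 0"
  have cst_0: "cst a = 0 \<longleftrightarrow> a = 0" for a using cst_eq_iff[of a 0] by (simp add: cst_simps)
  have "reflect_poly (map_poly cst p) = map_poly cst (reflect_poly p)"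
    by (rule poly_eqI) (auto simp: coeff_reflect_poly coeff_map_poly cst_simps(1) degree_map_poly cst_0)
  then have "Fract (reflect_poly p) 1 = poly (reflect_poly (map_poly cst p)) yc"
    by (simp add: poly_map_cst)
  also have "\<dots> = 0" using \<open>ev_inverse_y p = 0\<close> by (simp add: poly_reflect_poly_nz ev_inverse_y_def)
  finally show "p = 0" by (simp add: Zero_fract_def eq_fract)
qed simp

text \<open>
  The automorphism \<open>f(y) \<mapsto> f(y\<^sup>-\<^sup>1)\<close> of \<open>k(y)\<close>; its value does not depend on the chosen fraction, by
  \<open>invert_y_Fract\<close>.
\<close>

definition invert_y :: "'a poly fract \<Rightarrow> 'a poly fract" where
  "invert_y f = (SOME g. \<exists>a b. b \<noteq> 0 \<and> f = Fract a b \<and> g = ev_inverse_y a / ev_inverse_y b)"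

lemma invert_y_Fract:
  assumes "b \<noteq> 0"
  shows "invert_y (Fract a b) = ev_inverse_y a / ev_inverse_y b"
proof -
  have "\<exists>g a' b'. b' \<noteq> 0 \<and> Fract a b = Fract a' b' \<and> g = ev_inverse_y a' / ev_inverse_y b'" using assms by blast
  from someI_ex[OF this] obtain a' b' where
    *: "b' \<noteq> 0" "Fract a b = Fract a' b'" "invert_y (Fract a b) = ev_inverse_y a' / ev_inverse_y b'"
    unfolding invert_y_def by blast
  then have "a * b' = a' * b" using assms by (simp add: eq_fract)
  then have "ev_inverse_y a * ev_inverse_y b' = ev_inverse_y a' * ev_inverse_y b" by (metis ev_inverse_y_mult)
  then have "ev_inverse_y a / ev_inverse_y b = ev_inverse_y a' / ev_inverse_y b'" using * assms by (simp add: frac_eq_eq)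
  then show ?thesis using * by simp
qed

lemma invert_y_add: "invert_y (f + g) = invert_y f + invert_y g"
  by (cases f; cases g) (simp add: invert_y_Fract ev_inverse_y_add ev_inverse_y_mult field_simps)

lemma invert_y_mult: "invert_y (f * g) = invert_y f * invert_y g"
  by (cases f; cases g) (simp add: invert_y_Fract ev_inverse_y_mult)

lemma invert_y_eq_0_iff [simp]: "invert_y f = 0 \<longleftrightarrow> f = 0"
proof (cases f)
  case (Fract a b)
  have "Fract a b = 0 \<longleftrightarrow> a = 0" using Fract by (simp add: Zero_fract_def eq_fract)
  then show ?thesis using Fract by (simp add: invert_y_Fract)
qed

lemma ev_inverse_y_1 [simp]: "ev_inverse_y 1 = 1"
  by (simp add: one_pCons cst_simps)

lemma invert_y_cst [simp]: "invert_y (cst c) = cst c"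
  using invert_y_Fract[of 1 "[:c:]"] by (simp flip: cst_def)

lemma invert_y_1 [simp]: "invert_y 1 = 1"
  using invert_y_cst[of 1] by (simp add: cst_simps)

lemma invert_y_yc [simp]: "invert_y yc = inverse yc"
  using invert_y_Fract[of 1 "[:0, 1:]"] by (simp add: cst_simps flip: yc_def)

lemma invert_y_inverse [simp]: "invert_y (inverse f) = inverse (invert_y f)"
proof (cases "f = 0")
  case True
  then show ?thesis by (metis invert_y_eq_0_iff inverse_zero)
next
  case False
  then have "invert_y f * invert_y (inverse f) = 1" by (simp flip: invert_y_mult)
  then show ?thesis by (metis inverse_unique)
qed

lemma invert_y_sum: "invert_y (sum f A) = (\<Sum>i\<in>A. invert_y (f i))"
  by (induction A rule: infinite_finite_induct) (simp_all add: invert_y_add)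

text \<open>
  Inversion turns the dilation by \<open>q\<^sup>i\<close> into the one by \<open>q\<^sup>-\<^sup>i\<close>; this is what makes \<open>\<tau>\<close> multiplicative.
\<close>

lemma invert_y_qdil: "invert_y (qdil (q powi i) f) = qdil (q powi (- i)) (invert_y f)"
proof (cases f)
  case (Fract a b)
  have ev_inverse_y: "ev_inverse_y (pcompose p [:0, q powi i:]) = qdil (q powi (- i)) (ev_inverse_y p)" for p
  proof (induction p)
    case (pCons c p)
    have "inverse (cst (q powi (- i))) = cst (q powi i)"
    proof (rule inverse_unique)
      show "cst (q powi (- i)) * cst (q powi i) = 1"
        using q_nz by (simp add: power_int_minus cst_simps(2) flip: cst_simps(4))
    qed
    then show ?case
      unfolding ev_inverse_y_pCons qdil_simps qdil_cst qdil_inverse qdil_yc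
      using pCons by (simp add: pcompose_pCons ev_inverse_y_add ev_inverse_y_mult cst_simps algebra_simps ev_inverse_y_smult)
  qed simp
  have "q powi i \<noteq> 0" by (rule q_powi_nz)
  then have "qdil (q powi i) f = Fract (pcompose a [:0, q powi i:]) (pcompose b [:0, q powi i:])"
    using Fract qdil_Fract by blast
  moreover have "pcompose b [:0, q powi i:] \<noteq> 0"
    using Fract q_nz by (simp add: pcompose_dil_eq_0_iff)
  ultimately have "invert_y (qdil (q powi i) f) = qdil (q powi (- i)) (ev_inverse_y a) / qdil (q powi (- i)) (ev_inverse_y b)"
    using invert_y_Fract ev_inverse_y by simp
  also have "\<dots> = qdil (q powi (- i)) (invert_y f)"
    using Fract invert_y_Fract[of b a] by (simp only: qdil_divide) simp
  finally show ?thesis .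
qed

text \<open>
  The involution \<open>\<Sum> a\<^sub>i(y) x\<^sup>i \<mapsto> \<Sum> a\<^sub>i(y\<^sup>-\<^sup>1) x\<^sup>-\<^sup>i\<close>, meaningful on Laurent polynomials only, because it
  reverses the support.
\<close>

definition tau :: "'a poly fract fls \<Rightarrow> 'a poly fract fls" where
  "tau f = Abs_fls (\<lambda>n. invert_y (f $$ (- n)))"

lemma tau_nth:
  assumes "f \<in> laurent_polys"
  shows "tau f $$ n = invert_y (f $$ (- n))"
proof -
  obtain N where N: "\<forall>i>N. f $$ i = 0" using assms by (auto simp: laurent_polys_def)
  show ?thesis
    unfolding tau_def by (subst nth_Abs_fls_lower_bound[of "- N"]) (use N in auto)
qed

lemma tau_mul:
  assumes "f \<in> laurent_polys" "g \<in> laurent_polys"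
  shows "tau (f \<cdot> g) = tau f \<cdot> tau g"
proof (rule fls_eqI)
  fix n
  let ?I = "{i. f $$ i \<noteq> 0}"
  have fin: "finite ?I" using assms(1) by (simp add: laurent_polys_finite_support)
  have "tau (f \<cdot> g) $$ n = invert_y ((f \<cdot> g) $$ (- n))"
    using assms by (simp add: tau_nth laurent_polys_mul)
  also have "(f \<cdot> g) $$ (- n) = (\<Sum>i\<in>?I. f $$ i * qdil (q powi i) (g $$ (- n - i)))"
    by (rule skew_mult_nth') (use fin in auto)
  also have "invert_y \<dots> = (\<Sum>i\<in>?I. invert_y (f $$ i) * qdil (q powi (- i)) (invert_y (g $$ (- n - i))))"
    by (simp only: invert_y_sum invert_y_mult invert_y_qdil)
  also have "\<dots> = (\<Sum>i\<in>uminus ` ?I. tau f $$ i * qdil (q powi i) (tau g $$ (n - i)))"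
    by (rule sum.reindex_bij_witness[of _ uminus uminus])
      (use assms in \<open>auto simp: tau_nth\<close>)
  also have "\<dots> = (tau f \<cdot> tau g) $$ n"
    by (rule skew_mult_nth'[symmetric]) (use fin assms in \<open>auto simp: tau_nth image_iff\<close>)
  finally show "tau (f \<cdot> g) $$ n = (tau f \<cdot> tau g) $$ n" .
qed

lemma tau_add: "f \<in> laurent_polys \<Longrightarrow> g \<in> laurent_polys \<Longrightarrow> tau (f + g) = tau f + tau g"
  by (rule fls_eqI) (simp add: tau_nth laurent_polys_add invert_y_add)

lemma tau_eq_0_iff: "f \<in> laurent_polys \<Longrightarrow> tau f = 0 \<longleftrightarrow> f = 0"
proof -
  assume f: "f \<in> laurent_polys"
  have "f = 0" if "tau f = 0"
  proof (rule fls_eqI)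
    show "f $$ n = 0 $$ n" for n using arg_cong[OF that, of "\<lambda>g. g $$ (- n)"] f by (simp add: tau_nth)
  qed
  moreover have "tau 0 = 0" by (rule fls_eqI) (simp add: tau_nth)
  ultimately show ?thesis by auto
qed

lemma tau_mon: "tau (mon a n) = mon (invert_y a) (- n)"
  by (rule fls_eqI) (auto simp: tau_nth mon_nth)

text \<open>
  The elements of \<open>D\<close> fixed by the extension of \<open>\<tau>\<close> to \<open>D\<close>, expressed through Laurent polynomials alone:
  \<open>f = P Q\<^sup>-\<^sup>1 = \<tau>(P) \<tau>(Q)\<^sup>-\<^sup>1\<close> for some \<open>P\<close> and \<open>Q\<close>.
\<close>

definition tau_fixed :: "'a poly fract fls set" where
  "tau_fixed = {f. \<exists>Q\<in>laurent_polys. Q \<noteq> 0 \<and> f \<cdot> Q \<in> laurent_polys \<and> f \<cdot> tau Q = tau (f \<cdot> Q)}"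

lemma skew_field_tau_fixed: "skew_field tau_fixed"
  unfolding skew_field_def
proof (intro conjI allI ballI impI)
  show "qscal c \<in> tau_fixed" for c
    unfolding tau_fixed_def using q_nz
    by (intro CollectI bexI[of _ 1]) (auto simp: mon_simps tau_mon mon_mul_mon)
next
  fix f g
  assume "f \<in> tau_fixed" "g \<in> tau_fixed"
  then obtain Q Q' where Q: "Q \<in> laurent_polys" "Q' \<in> laurent_polys" "Q \<noteq> 0" "Q' \<noteq> 0" "f \<cdot> Q \<in> laurent_polys" "g \<cdot> Q' \<in> laurent_polys"
    "f \<cdot> tau Q = tau (f \<cdot> Q)" "g \<cdot> tau Q' = tau (g \<cdot> Q')"
    unfolding tau_fixed_def by blast
  obtain s t where st: "s \<in> laurent_polys" "t \<in> laurent_polys" "s \<noteq> 0" "t \<noteq> 0" "Q \<cdot> s = Q' \<cdot> t"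
    using ore Q by blast
  have sum: "(f + g) \<cdot> (Q \<cdot> s) = f \<cdot> Q \<cdot> s + g \<cdot> Q' \<cdot> t"
    using st(5) by (simp add: distribs assoc)
  have "tau Q \<cdot> tau s = tau Q' \<cdot> tau t" using st Q by (metis tau_mul)
  then have "(f + g) \<cdot> tau (Q \<cdot> s) = f \<cdot> tau Q \<cdot> tau s + g \<cdot> tau Q' \<cdot> tau t"
    using Q(1-4) st(1-4) by (simp add: tau_mul distribs assoc)
  also have "\<dots> = tau ((f + g) \<cdot> (Q \<cdot> s))"
    unfolding sum Q(7,8) using Q st by (simp add: tau_add tau_mul laurent_polys_mul)
  finally show "f + g \<in> tau_fixed"
    using sum Q st unfolding tau_fixed_def by (intro CollectI bexI[of _ "Q \<cdot> s"]) auto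
  show "f \<cdot> g \<in> tau_fixed"
  proof (cases "g = 0")
    case True
    then show ?thesis
      unfolding tau_fixed_def by (intro CollectI bexI[of _ 1]) (auto simp: tau_eq_0_iff)
  next
    case False
    then obtain s t where st: "s \<in> laurent_polys" "t \<in> laurent_polys" "s \<noteq> 0" "t \<noteq> 0" "g \<cdot> Q' \<cdot> s = Q \<cdot> t"
      using ore[of "g \<cdot> Q'" Q] Q by auto
    have prod: "f \<cdot> g \<cdot> (Q' \<cdot> s) = f \<cdot> Q \<cdot> t" using st(5) by (simp add: assoc)
    have "g \<cdot> tau Q' \<cdot> tau s = tau Q \<cdot> tau t"
      using st Q by (metis tau_mul)
    then have "f \<cdot> g \<cdot> tau (Q' \<cdot> s) = f \<cdot> tau Q \<cdot> tau t"
      using Q(2) st(1) by (simp add: tau_mul assoc)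
    also have "\<dots> = tau (f \<cdot> g \<cdot> (Q' \<cdot> s))"
      unfolding prod Q(7) using Q st by (simp add: tau_mul)
    finally show ?thesis
      using prod Q st unfolding tau_fixed_def by (intro CollectI bexI[of _ "Q' \<cdot> s"]) auto
  qed
next
  fix f
  assume f: "f \<in> tau_fixed" "f \<noteq> 0"
  then obtain Q where Q: "Q \<in> laurent_polys" "Q \<noteq> 0" "f \<cdot> Q \<in> laurent_polys" "f \<cdot> tau Q = tau (f \<cdot> Q)"
    unfolding tau_fixed_def by blast
  have "iv f \<cdot> tau (f \<cdot> Q) = tau Q" using f Q(4) by (simp flip: Q(4))
  then show "iv f \<in> tau_fixed"
    using f Q unfolding tau_fixed_def by (intro CollectI bexI[of _ "f \<cdot> Q"]) auto
qed

lemma laurent_polys_tau_fixed_iff: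
  assumes "f \<in> laurent_polys"
  shows "f \<in> tau_fixed \<longleftrightarrow> tau f = f"
proof
  assume "f \<in> tau_fixed"
  then obtain Q where Q: "Q \<in> laurent_polys" "Q \<noteq> 0" "f \<cdot> Q \<in> laurent_polys" "f \<cdot> tau Q = tau (f \<cdot> Q)"
    unfolding tau_fixed_def by blast
  then have "f \<cdot> tau Q = tau f \<cdot> tau Q" using assms by (simp add: tau_mul)
  moreover have "tau Q \<noteq> 0" using Q by (simp add: tau_eq_0_iff)
  ultimately show "tau f = f" by (simp add: right_cancel)
next
  assume "tau f = f"
  moreover have "tau 1 = 1" by (simp add: mon_simps tau_mon)
  ultimately show "f \<in> tau_fixed"
    unfolding tau_fixed_def using assms by (intro CollectI bexI[of _ 1]) auto
qed

section \<open>An invariant q-commuting pair\<close>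

text \<open>
  \<open>A\<close>, \<open>B\<close> and \<open>T\<close> are fixed by \<open>\<tau>\<close>, while \<open>h\<close>, \<open>S\<close> and \<open>r\<close> change sign.  For \<open>q = 1\<close> the invariant
  \<open>Y = M\<^sup>-\<^sup>1 N = (y - x y\<^sup>-\<^sup>1) / (1 - x)\<close> and \<open>u = A Y - Y\<^sup>2 - 1\<close> are coordinates on the quotient of the torus by
  inversion, and \<open>(u, Y)\<close> has the same logarithmic volume form as \<open>(x, y)\<close>.  The factor \<open>K\<close> is what
  \<open>A\<close> becomes when \<open>M\<close> is moved past it, up to a multiple of \<open>N\<close>.
\<close>

abbreviation "X \<equiv> mon 1 1"
abbreviation "Xi \<equiv> mon 1 (- 1)"
abbreviation "y \<equiv> mon yc 0"
abbreviation "yi \<equiv> mon (inverse yc) 0"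

definition "A = y + yi"
definition "B = X + Xi"
definition "T = X \<cdot> yi + Xi \<cdot> y"
definition "M = 1 - X"
definition "N = y - X \<cdot> yi"
definition "K = qscal q \<cdot> y + yi"
definition "Y = iv M \<cdot> N"
definition "u = A \<cdot> Y - Y \<cdot> Y - 1"
definition "h = X - Xi"
definition "S = X \<cdot> yi - Xi \<cdot> y"
definition "r = y - yi"

lemmas elem_defs = A_def B_def T_def M_def N_def K_def h_def S_def r_def

lemma cst_inverse: "cst (inverse a) = inverse (cst a)"
proof (cases "a = 0")
  case False
  then have "cst a * cst (inverse a) = 1" by (simp add: cst_simps(2) flip: cst_simps(4))
  then show ?thesis by (metis inverse_unique)
qed (simp add: cst_simps)

lemma cst_power: "cst (a ^ n) = cst a ^ n"
  by (induction n) (simp_all add: cst_simps)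

lemma cst_powi: "cst (a powi n) = cst a powi n"
  by (simp add: power_int_def cst_power cst_inverse flip: power_inverse)

lemma cst_numeral: "cst (numeral n) = numeral n"
proof -
  have "cst (of_nat m) = of_nat m" for m by (induction m) (simp_all add: cst_simps)
  from this[of "numeral n"] show ?thesis by simp
qed

lemma cst_q_nz [simp]: "cst q \<noteq> 0"
  using q_nz cst_eq_iff[of q 0] by (simp add: cst_simps)

lemma cst_divide: "cst (a / b) = cst a / cst b"
  by (simp add: divide_inverse cst_simps cst_inverse)

text \<open>
  The identities between explicit Laurent polynomials are proved by expanding both sides into monomials
  with \<open>expand_monomials\<close> and comparing coefficients in \<open>k(y)\<close> with \<open>scalar_simps\<close>.
\<close>

lemmas expand_monomials = mon_simps distribs mon_mul_mon mult_1_left mult_1_right qdil_simps(1-3) qdil_minus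
  qdil_inverse qdil_cst qdil_yc
lemmas scalar_simps = cst_simps cst_powi cst_numeral cst_inverse cst_divide

lemma M_nz: "M \<noteq> 0"
proof -
  have "M $$ 0 = 1" by (simp add: M_def mon_simps mon_nth)
  then show ?thesis by auto
qed

lemma MY: "M \<cdot> Y = N"
  using M_nz by (simp add: Y_def)

text \<open>
  The Riccati equation \<open>A Y - q Y A = (1 - q) (Y\<^sup>2 + 1)\<close>, which is the lemma \<open>u_alt\<close> below, becomes
  \<open>K N - q N A + (q - 1) M = 0\<close> when it is multiplied by \<open>M\<close> from the left: \<open>MA\<close> moves \<open>M\<close> past \<open>A\<close>, and
  \<open>M Y\<close> is \<open>N\<close>.  The result is \<open>KN\<close>.
\<close>

lemma MA: "M \<cdot> A = K \<cdot> M - qscal (q - 1) \<cdot> N"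
  unfolding elem_defs expand_monomials by (rule fls_eqI) (auto simp: mon_nth scalar_simps field_simps)

lemma KN: "K \<cdot> N = qscal q \<cdot> N \<cdot> A - qscal (q - 1) \<cdot> M"
  unfolding elem_defs expand_monomials by (rule fls_eqI) (auto simp: mon_nth scalar_simps field_simps)

text \<open>
  \<open>M2\<close> is \<open>(1 - q x) (1 - q\<^sup>-\<^sup>1 x)\<close>: with the dilated factors of \<open>M = 1 - x\<close> in it, \<open>M2\<close> makes the denominator
  of \<open>N Y = N M\<^sup>-\<^sup>1 N\<close> cancel (\<open>M2N\<close>).  It is written in terms of \<open>B\<close> because \<open>M2\<close> serves to express
  \<open>B\<close> through \<open>Y\<close> and \<open>u\<close>.
\<close>

definition "M2 = X \<cdot> (B - qscal (q + inverse q))"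
definition "L2 = (1 - qscal q \<cdot> X) \<cdot> y - X \<cdot> (1 - qscal (inverse q) \<cdot> X) \<cdot> yi"

lemma M2N: "M2 \<cdot> N = L2 \<cdot> M"
  unfolding elem_defs expand_monomials M2_def L2_def
  by (rule fls_eqI) (auto simp: mon_nth scalar_simps field_simps power2_eq_square)

lemma M2M: "M2 \<cdot> M = M \<cdot> M2"
  unfolding elem_defs expand_monomials M2_def L2_def
  by (rule fls_eqI) (auto simp: mon_nth scalar_simps field_simps power2_eq_square)

text \<open>
  The identity \<open>M2u\<close> below, multiplied by \<open>M\<close> from the left so that \<open>Y\<close> does not occur in it.
\<close>

lemma M2_id: "M2 \<cdot> K \<cdot> N - M2 \<cdot> M - qscal q \<cdot> L2 \<cdot> N
  = - (X \<cdot> (qscal q \<cdot> M \<cdot> A \<cdot> A - qscal (q - 1) \<cdot> N \<cdot> A - qscal (2 * (q + 1)) \<cdot> M))"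
  unfolding elem_defs expand_monomials M2_def L2_def
  by (rule fls_eqI) (auto simp: mon_nth scalar_simps field_simps power2_eq_square)

lemma BTA: "B - qscal 2 = (Xi - 1) \<cdot> M" "T - A = (Xi - 1) \<cdot> N"
  unfolding elem_defs expand_monomials
  by ((rule fls_eqI), auto simp: mon_nth scalar_simps field_simps power2_eq_square)+

lemma hB: "h \<cdot> B = B \<cdot> h" and hh: "h \<cdot> h = B \<cdot> B - qscal 4"
  unfolding elem_defs expand_monomials
  by ((rule fls_eqI), auto simp: mon_nth scalar_simps field_simps power2_eq_square)+

text \<open>
  Conjugation by \<open>h\<close>, made explicit: both \<open>h A, h T\<close> and \<open>A h, T h\<close> are combinations of the
  anti-invariants \<open>S\<close> and \<open>r\<close> with coefficients in \<open>k(B)\<close>.  Solving the second pair for \<open>S\<close> and \<open>r\<close> brings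
  \<open>h A\<close> and \<open>h T\<close> into the form \<open>e h\<close>.
\<close>

lemma hA: "h \<cdot> A = qscal 2 \<cdot> S + B \<cdot> r"
   and Ah: "A \<cdot> h = qscal (q + inverse q) \<cdot> S + qscal (inverse q) \<cdot> B \<cdot> r"
   and hT: "h \<cdot> T = B \<cdot> S + qscal 2 \<cdot> r"
   and Th: "T \<cdot> h = qscal q \<cdot> B \<cdot> S + qscal (q + inverse q) \<cdot> r"
  unfolding elem_defs expand_monomials
  by ((rule fls_eqI), auto simp: mon_nth scalar_simps field_simps power2_eq_square)+

lemma Mu: "M \<cdot> u = K \<cdot> N - qscal q \<cdot> (N \<cdot> Y) - M"
proof -
  have "M \<cdot> u = M \<cdot> A \<cdot> Y - M \<cdot> Y \<cdot> Y - M"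
    by (simp add: u_def diff_right assoc)
  also have "\<dots> = K \<cdot> (M \<cdot> Y) - qscal (q - 1) \<cdot> (N \<cdot> Y) - N \<cdot> Y - M"
    unfolding MA MY by (simp add: diff_left assoc MY)
  also have "qscal (q - 1) \<cdot> (N \<cdot> Y) = qscal q \<cdot> (N \<cdot> Y) - N \<cdot> Y"
    using qscal_simps(5)[of q "- 1"] by (simp add: qscal_simps distribs)
  finally show ?thesis by (simp add: MY)
qed

lemma scal_left: "f \<cdot> (qscal c \<cdot> g) = qscal c \<cdot> (f \<cdot> g)"
  by (metis assoc qscal_commute)

lemma u_alt: "u = qscal q \<cdot> (Y \<cdot> A - Y \<cdot> Y - 1)"
proof -
  have q1: "qscal (q - 1) = qscal q - (1 :: 'a poly fract fls)"
    using qscal_simps(5)[of q "- 1"] by (simp add: qscal_simps)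
  have "M \<cdot> (qscal q \<cdot> (Y \<cdot> A - Y \<cdot> Y - 1)) = qscal q \<cdot> (M \<cdot> Y \<cdot> A - M \<cdot> Y \<cdot> Y - M)"
    by (simp add: scal_left distribs assoc qscal_commute[of M])
  also have "\<dots> = qscal q \<cdot> N \<cdot> A - qscal q \<cdot> (N \<cdot> Y) - qscal q \<cdot> M"
    by (simp add: MY distribs assoc)
  also have "\<dots> = M \<cdot> u"
    unfolding Mu KN q1 by (simp add: distribs)
  finally show ?thesis using left_cancel[OF M_nz] by metis
qed

text \<open>
  By the definition of \<open>u\<close> and by \<open>u_alt\<close>, both sides are \<open>q\<close> times \<open>Y A Y - Y\<^sup>3 - Y\<close>.
\<close>

lemma uY: "u \<cdot> Y = qscal q \<cdot> Y \<cdot> u"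
proof -
  have "u \<cdot> Y = qscal q \<cdot> (Y \<cdot> A - Y \<cdot> Y - 1) \<cdot> Y" by (simp only: flip: u_alt)
  also have "\<dots> = qscal q \<cdot> Y \<cdot> u"
    by (simp add: u_def distribs assoc)
  finally show ?thesis .
qed

text \<open>
  Classically \<open>B - 2\<close> is \<open>- (A\<^sup>2 - 4) / u\<close>.  The quantum version is \<open>M2u\<close> below: cancelling \<open>x\<close>, it gives
  \<open>B = q + q\<^sup>-\<^sup>1 - W u\<^sup>-\<^sup>1\<close>.
\<close>

definition "W = qscal q \<cdot> A \<cdot> A - qscal (q - 1) \<cdot> Y \<cdot> A - qscal (2 * (q + 1))"

lemma MW: "M \<cdot> W = qscal q \<cdot> M \<cdot> A \<cdot> A - qscal (q - 1) \<cdot> N \<cdot> A - qscal (2 * (q + 1)) \<cdot> M"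
  unfolding W_def by (simp add: distribs assoc scal_left qscal_commute flip: MY)

lemma M2u: "M2 \<cdot> u = - (X \<cdot> W)"
proof -
  have "M \<cdot> (M2 \<cdot> u) = M2 \<cdot> (M \<cdot> u)" by (simp add: M2M flip: assoc)
  also have "\<dots> = M2 \<cdot> K \<cdot> N - M2 \<cdot> M - qscal q \<cdot> (M2 \<cdot> N \<cdot> Y)"
    unfolding Mu by (simp add: distribs assoc scal_left)
  also have "M2 \<cdot> N \<cdot> Y = L2 \<cdot> N" unfolding M2N by (simp add: assoc MY)
  also have "M2 \<cdot> K \<cdot> N - M2 \<cdot> M - qscal q \<cdot> (L2 \<cdot> N) = - (X \<cdot> (M \<cdot> W))"
    using M2_id unfolding MW by (simp add: assoc)
  also have "\<dots> = M \<cdot> (- (X \<cdot> W))"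
  proof -
    have "X \<cdot> M = M \<cdot> X" by (simp add: M_def distribs)
    then show ?thesis by (simp add: minus_right flip: assoc)
  qed
  finally show ?thesis using left_cancel[OF M_nz] by metis
qed

text \<open>
  If \<open>u\<close> were \<open>0\<close>, then so would be \<open>M W\<close>, whose constant term is \<open>y\<^sup>-\<^sup>2 (y\<^sup>2 - 1) (y\<^sup>2 - q)\<close>.
\<close>

lemma u_nz: "u \<noteq> 0"
proof
  assume "u = 0"
  then have "W = 0" using M2u by simp
  then have "(M \<cdot> W) $$ 0 = 0" by simp
  then have "cst q * (yc + inverse yc) * (yc + inverse yc) - (cst q - 1) * yc * (yc + inverse yc)
      - 2 * (cst q + 1) = 0"
    unfolding MW unfolding elem_defs expand_monomials by (simp add: mon_nth scalar_simps algebra_simps)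
  moreover have "(yc * yc - 1) * (yc * yc - cst q) = yc * yc * (cst q * (yc + inverse yc) * (yc + inverse yc)
      - (cst q - 1) * yc * (yc + inverse yc) - 2 * (cst q + 1))"
    by (simp add: field_simps)
  ultimately have "(yc * yc - 1) * (yc * yc - cst q) = 0" by simp
  moreover have "yc * yc \<noteq> cst d" for d by (simp add: yc_def cst_def eq_fract)
  then have "yc * yc \<noteq> 1" "yc * yc \<noteq> cst q" by (metis cst_simps(2))+
  ultimately show False by simp
qed

lemma BY: "(B - qscal 2) \<cdot> Y = T - A"
  unfolding BTA by (simp add: assoc MY)

lemma B_coeff: "B $$ 1 = 1" "qscal c $$ 1 = (0 :: 'a poly fract)"
  by (simp_all add: B_def mon_nth mon_simps)

text \<open>
  \<open>Y = (B - 2)\<^sup>-\<^sup>1 (T - A)\<close> exhibits \<open>Y\<close> as a fraction of \<open>\<tau>\<close>-invariant Laurent polynomials, which \<open>M\<close> and \<open>N\<close>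
  are not.
\<close>

lemma Y_in:
  assumes "skew_field V" "A \<in> V" "B \<in> V" "T \<in> V"
  shows "Y \<in> V"
proof -
  have "(B - qscal 2) $$ 1 = 1" by (simp add: B_coeff)
  then have nz: "B - qscal 2 \<noteq> 0" by auto
  then have "Y = iv (B - qscal 2) \<cdot> (T - A)" by (simp flip: BY)
  moreover have "iv (B - qscal 2) \<cdot> (T - A) \<in> V"
    using nz by (intro skew_field_intros[OF assms(1)] assms)
  ultimately show ?thesis by simp
qed

lemma Y_nth: "i < 0 \<Longrightarrow> Y $$ i = 0" "Y $$ 0 = yc"
proof -
  have rec: "Y $$ n = N $$ n + qdil (q powi 1) (Y $$ (n - 1))" for n
    using arg_cong[OF MY, of "\<lambda>f. f $$ n"] by (simp add: M_def distribs mon_mul_nth diff_eq_eq)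
  have N: "N $$ n = (if n = 0 then yc else 0)" if "n \<le> 0" for n
    using that unfolding N_def expand_monomials by (simp add: mon_nth)
  have "fls_subdegree Y \<ge> 0"
  proof (rule ccontr)
    assume *: "\<not> fls_subdegree Y \<ge> 0"
    then have "Y $$ fls_subdegree Y = 0"
      using rec[of "fls_subdegree Y"] N[of "fls_subdegree Y"] by simp
    then show False using * by (metis nth_fls_subdegree_zero_iff fls_zero_subdegree order_refl)
  qed
  then show *: "i < 0 \<Longrightarrow> Y $$ i = 0" for i by simp
  show "Y $$ 0 = yc" using rec[of 0] *[of "- 1"] N[of 0] by simp
qed

text \<open>
  So \<open>(A, B, T)\<close> and \<open>(Y, u)\<close> generate the same division ring; the first triple is convenient for \<open>\<tau>\<close> and
  for conjugation by \<open>h\<close>, the second for \<open>q_pair_conj\<close>.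
\<close>

lemma AB_in:
  assumes V: "skew_field V" and YV: "Y \<in> V" "u \<in> V"
  shows "A \<in> V" "B \<in> V" "T \<in> V"
proof -
  have "Y \<noteq> 0" using Y_nth(2) by auto
  have "A \<cdot> Y = u + Y \<cdot> Y + 1" by (simp add: u_def)
  then have "A = (u + Y \<cdot> Y + 1) \<cdot> iv Y" using \<open>Y \<noteq> 0\<close> by (metis assoc iv_right one_right)
  moreover have "(u + Y \<cdot> Y + 1) \<cdot> iv Y \<in> V"
    using \<open>Y \<noteq> 0\<close> YV by (intro skew_field_intros V)
  ultimately show A: "A \<in> V" by simp
  have "X \<cdot> ((B - qscal (q + inverse q)) \<cdot> u) = X \<cdot> (- W)"
    using M2u by (simp add: M2_def assoc minus_right)
  moreover have "X \<noteq> 0" by simp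
  ultimately have "(B - qscal (q + inverse q)) \<cdot> u = - W" using left_cancel by blast
  then have "B - qscal (q + inverse q) = - W \<cdot> iv u" using u_nz by (metis assoc iv_right one_right)
  then have "B = qscal (q + inverse q) - W \<cdot> iv u" by (simp add: minus_left algebra_simps)
  moreover have "W \<in> V" unfolding W_def using A YV by (intro skew_field_intros V)
  then have "qscal (q + inverse q) - W \<cdot> iv u \<in> V"
    using YV u_nz by (intro skew_field_intros V)
  ultimately show B: "B \<in> V" by simp
  have "T = (B - qscal 2) \<cdot> Y + A" by (simp add: BY)
  also have "\<dots> \<in> V" using A B YV by (intro skew_field_intros V)
  finally show "T \<in> V" .
qed

lemma laurent_polys_elems [simp]: "A \<in> laurent_polys" "B \<in> laurent_polys" "T \<in> laurent_polys" "h \<in> laurent_polys"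
  by (auto simp: elem_defs)

lemma u_in: "skew_field V \<Longrightarrow> A \<in> V \<Longrightarrow> B \<in> V \<Longrightarrow> T \<in> V \<Longrightarrow> u \<in> V"
  using Y_in unfolding u_def by (auto intro: skew_field_intros)

lemma ABT_tau_fixed: "A \<in> tau_fixed" "B \<in> tau_fixed" "T \<in> tau_fixed"
  by (simp_all add: laurent_polys_tau_fixed_iff)
    (simp_all add: elem_defs tau_add tau_mul tau_mon invert_y_add laurent_polys_mul add.commute)

lemma h_not_tau_fixed: "h \<notin> tau_fixed"
proof
  assume "h \<in> tau_fixed"
  then have "tau h $$ 1 = h $$ 1" by (simp add: laurent_polys_tau_fixed_iff)
  then have "invert_y (- 1) = 1" by (simp add: tau_nth) (simp add: h_def mon_nth)
  moreover have "invert_y (- 1) = - 1" using invert_y_cst[of "- 1"] by (simp add: cst_simps)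
  ultimately have "cst (- 1) = cst 1" by (simp add: cst_simps)
  then show False by (simp only: cst_eq_iff) simp
qed

lemma y_not_tau_fixed: "y \<notin> tau_fixed"
proof
  assume "y \<in> tau_fixed"
  then have "tau y $$ 0 = y $$ 0" by (simp add: laurent_polys_tau_fixed_iff)
  then have "yc * yc = 1" by (simp add: tau_mon mon_nth field_simps)
  then show False by (simp add: yc_def One_fract_def eq_fract one_pCons)
qed

lemma h_nz: "h \<noteq> 0"
proof -
  have "h $$ 1 = 1" by (simp add: h_def mon_nth)
  then show ?thesis by auto
qed

text \<open>
  The determinant \<open>(q + q\<^sup>-\<^sup>1)\<^sup>2 - B\<^sup>2\<close> of the system \<open>Ah\<close>, \<open>Th\<close> lies in \<open>k(B)\<close> and is nonzero, so
  \<open>S\<close> and \<open>r\<close> belong to \<open>V h\<close>, and with them \<open>h A\<close> and \<open>h T\<close>.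
\<close>

lemma h_normalises:
  assumes V: "skew_field V" and YV: "Y \<in> V" "u \<in> V"
  shows "cj h A \<in> V" "cj h B \<in> V" "cj h T \<in> V"
proof -
  note ABT = AB_in[OF V YV]
  define s where "s = qscal (q + inverse q)"
  define D where "D = s \<cdot> s - B \<cdot> B"
  have D: "D \<in> V" unfolding D_def s_def using ABT by (intro skew_field_intros V)
  have "D $$ 2 = - 1"
    unfolding D_def s_def elem_defs expand_monomials by (simp add: mon_nth)
  then have D_nz: "D \<noteq> 0" by auto
  have sB: "s \<cdot> (B \<cdot> f) = B \<cdot> (s \<cdot> f)" for f unfolding s_def by (metis assoc qscal_commute)
  have qiq: "qscal q \<cdot> (qscal (inverse q) \<cdot> f) = f" "qscal (inverse q) \<cdot> (qscal q \<cdot> f) = f" for f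
    using q_nz by (simp_all add: assoc[symmetric] qscal_simps(2) flip: qscal_simps(4))
  have scalB: "B \<cdot> (qscal c \<cdot> f) = qscal c \<cdot> (B \<cdot> f)"
    "s \<cdot> (qscal c \<cdot> f) = qscal c \<cdot> (s \<cdot> f)" for c f by (rule scal_left)+
  define e1 where "e1 = iv D \<cdot> (s \<cdot> A - qscal (inverse q) \<cdot> B \<cdot> T)"
  define e2 where "e2 = iv D \<cdot> (s \<cdot> T - qscal q \<cdot> B \<cdot> A)"
  have "(s \<cdot> A - qscal (inverse q) \<cdot> B \<cdot> T) \<cdot> h = D \<cdot> S"
    unfolding diff_left assoc Ah Th D_def
    by (simp add: distribs assoc scalB qiq sB flip: s_def)
  then have S: "S = e1 \<cdot> h" unfolding e1_def using D_nz by (simp add: assoc)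
  have "(s \<cdot> T - qscal q \<cdot> B \<cdot> A) \<cdot> h = D \<cdot> r"
    unfolding diff_left assoc Ah Th D_def
    by (simp add: distribs assoc scalB qiq sB flip: s_def)
  then have r: "r = e2 \<cdot> h" unfolding e2_def using D_nz by (simp add: assoc)
  have e: "e1 \<in> V" "e2 \<in> V"
    unfolding e1_def e2_def s_def using ABT D D_nz by (auto intro!: skew_field_intros V)
  have "h \<cdot> A = (qscal 2 \<cdot> e1 + B \<cdot> e2) \<cdot> h" unfolding hA S r by (simp add: distribs assoc)
  then have "cj h A = qscal 2 \<cdot> e1 + B \<cdot> e2" using h_nz by (intro cj_eqI)
  then show "cj h A \<in> V" using e ABT by (auto intro!: skew_field_intros V)
  have "h \<cdot> T = (B \<cdot> e1 + qscal 2 \<cdot> e2) \<cdot> h" unfolding hT S r by (simp add: distribs assoc)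
  then have "cj h T = B \<cdot> e1 + qscal 2 \<cdot> e2" using h_nz by (intro cj_eqI)
  then show "cj h T \<in> V" using e ABT by (auto intro!: skew_field_intros V)
  have "cj h B = B" using hB h_nz by (intro cj_eqI)
  then show "cj h B \<in> V" using ABT by simp
qed

section \<open>The two conjugations\<close>

text \<open>
  The image \<open>E = c\<^sub>z(D)\<close> for the pair \<open>(Y, u)\<close>, as the smallest division ring containing it.
\<close>

lemma embedding:
  obtains z where "z \<noteq> 0" "skew_field (cj z ` qdiv q)" "Y \<in> cj z ` qdiv q" "u \<in> cj z ` qdiv q"
    "\<And>V. skew_field V \<Longrightarrow> Y \<in> V \<Longrightarrow> u \<in> V \<Longrightarrow> cj z ` qdiv q \<subseteq> V"
proof -
  obtain z a where z: "z \<noteq> 0" "cj z qy = Y" "cj z (mon a 1) = u"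
    "\<And>V. skew_field V \<Longrightarrow> Y \<in> V \<Longrightarrow> u \<in> V \<Longrightarrow> cj z ` qdiv q \<subseteq> V"
    by (rule q_pair_conj[of Y u]) (use Y_nth u_nz uY in auto)
  have "cj z ` qdiv q = cj (iv z) -` qdiv q"
    using z(1) by (force simp: image_iff)
  moreover have "skew_field (cj (iv z) -` qdiv q)"
    using z(1) by (intro skew_field_vimage skew_field_qdiv) simp
  moreover have "qy \<in> qdiv q" "mon a 1 \<in> qdiv q"
    using laurent_polys_subset_qdiv by (auto simp: mon_simps)
  ultimately show ?thesis using that z by (metis image_eqI)
qed

text \<open>
  \<open>v = z\<^sup>-\<^sup>1 h z\<close> acts on \<open>D\<close> as \<open>h\<close> acts on \<open>E\<close>.  That \<open>c\<^sub>h\<close> is onto \<open>E\<close> follows from \<open>h\<^sup>2 \<in> E\<close>: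
  conjugation by \<open>h\<^sup>-\<^sup>1\<close> is \<open>c\<^sub>h\<close> followed by an inner automorphism of \<open>E\<close>.
\<close>

lemma ex_bijective_square:
  "\<exists>z. z \<notin> qdiv q \<and> z \<noteq> 0 \<and> bij_betw (cj z) (qdiv q) (qdiv q) \<and> z \<cdot> z \<in> qdiv q"
proof -
  obtain z where z: "z \<noteq> 0" "skew_field (cj z ` qdiv q)" "Y \<in> cj z ` qdiv q" "u \<in> cj z ` qdiv q"
    "\<And>V. skew_field V \<Longrightarrow> Y \<in> V \<Longrightarrow> u \<in> V \<Longrightarrow> cj z ` qdiv q \<subseteq> V"
    using embedding by blast
  define E where "E = cj z ` qdiv q"
  note E = z(2-4)[folded E_def]
  have hE: "cj h ` E \<subseteq> E"
  proof -
    have V: "skew_field (cj h -` E)" using E h_nz by (intro skew_field_vimage)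
    have "A \<in> cj h -` E" "B \<in> cj h -` E" "T \<in> cj h -` E"
      using h_normalises[OF E] by auto
    then have "Y \<in> cj h -` E" "u \<in> cj h -` E" using V Y_in u_in by auto
    then have "E \<subseteq> cj h -` E" using V z(5) by (simp add: E_def)
    then show ?thesis by auto
  qed
  have hhE: "h \<cdot> h \<in> E"
    unfolding hh using AB_in[OF E] by (intro skew_field_intros E(1))
  have hE': "cj (iv h) ` E \<subseteq> E"
  proof clarify
    fix e assume "e \<in> E"
    then have "cj h e \<in> E" using hE by blast
    then have "iv (h \<cdot> h) \<cdot> cj h e \<cdot> (h \<cdot> h) \<in> E"
      using hhE h_nz E(1) by (auto intro!: skew_field_mul skew_field_iv)
    moreover have "iv (h \<cdot> h) \<cdot> cj h e \<cdot> (h \<cdot> h) = cj (iv h) e"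
      using h_nz by (simp add: cj_def iv_mul assoc)
    ultimately show "cj (iv h) e \<in> E" by simp
  qed
  define v where "v = cj (iv z) h"
  have v0: "v \<noteq> 0" using h_nz z(1) by (simp add: v_def cj_0_iff)
  have zv: "cj z v = h" using z(1) by (simp add: v_def)
  have conj: "cj v f = cj (iv z) (cj h (cj z f))" for f
    using z(1) h_nz by (simp add: v_def cj_def iv_mul assoc)
  have conj': "cj (iv v) f = cj (iv z) (cj (iv h) (cj z f))" for f
    using z(1) h_nz by (simp add: v_def cj_def iv_mul assoc)
  have push: "cj z f \<in> E" if "f \<in> qdiv q" for f using that by (simp add: E_def)
  have pull_back: "cj (iv z) g \<in> qdiv q" if "g \<in> E" for g
    using that z(1) by (auto simp: E_def)
  have "cj v ` qdiv q \<subseteq> qdiv q" "cj (iv v) ` qdiv q \<subseteq> qdiv q"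
    using hE hE' by (auto simp: conj conj' image_subset_iff intro!: pull_back push)
  then have "bij_betw (cj v) (qdiv q) (qdiv q)" using v0 by (intro bij_betw_cj)
  moreover have "v \<cdot> v = cj (iv z) (h \<cdot> h)" using z(1) by (simp add: v_def cj_mul)
  then have "v \<cdot> v \<in> qdiv q" using pull_back hhE by simp
  moreover have "v \<notin> qdiv q"
  proof
    assume "v \<in> qdiv q"
    then have "h \<in> E" using push[of v] zv by simp
    moreover have "E \<subseteq> tau_fixed"
      unfolding E_def
      by (intro z(5) skew_field_tau_fixed Y_in u_in ABT_tau_fixed)
    ultimately show False using h_not_tau_fixed by blast
  qed
  ultimately show ?thesis using v0 by blast
qed

lemma ex_nonsurjective:
  "\<exists>z. z \<noteq> 0 \<and> cj z ` qdiv q \<subset> qdiv q"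
proof -
  obtain z where z: "z \<noteq> 0"
    "\<And>V. skew_field V \<Longrightarrow> Y \<in> V \<Longrightarrow> u \<in> V \<Longrightarrow> cj z ` qdiv q \<subseteq> V"
    using embedding by metis
  have "A \<in> qdiv q" "B \<in> qdiv q" "T \<in> qdiv q" using laurent_polys_subset_qdiv by auto
  then have "cj z ` qdiv q \<subseteq> qdiv q"
    by (intro z(2) skew_field_qdiv Y_in u_in)
  moreover have "cj z ` qdiv q \<subseteq> tau_fixed"
    by (intro z(2) skew_field_tau_fixed Y_in u_in ABT_tau_fixed)
  moreover have "y \<in> qdiv q" using laurent_polys_subset_qdiv by auto
  ultimately show ?thesis using z(1) y_not_tau_fixed by blast
qed

lemma qconj_End:
  assumes "z \<noteq> 0" "cj z ` qdiv q \<subseteq> qdiv q"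
  shows "qconj q z \<in> qdiv_End q"
proof -
  have "qconj q z \<in> ring_hom (qdiv_ring q) (qdiv_ring q)"
    using assms by (intro ring_hom_memI) (auto simp: qdiv_ring_def qconj_eq cj_mul cj_add cj_1)
  then show ?thesis
    using assms by (simp add: qdiv_End_def qconj_eq cj_mul cj_qscal)
qed

end

theorem theorem1p3p4:
  fixes q :: "'a::field_char_0"
  assumes "q \<noteq> 0"
    and "\<forall>n::nat. n > 0 \<longrightarrow> q ^ n \<noteq> 1"
  shows "(\<exists>z \<in> carrier (qLaurent q) - qdiv q. bij_betw (qconj q z) (qdiv q) (qdiv q))
    \<and> (\<exists>z \<in> carrier (qLaurent q) - qdiv q. bij_betw (qconj q z) (qdiv q) (qdiv q)
          \<and> (\<exists>n::nat. n > 0 \<and> z [^]\<^bsub>qLaurent q\<^esub> n \<in> qdiv q))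
    \<and> (\<exists>z \<in> carrier (qLaurent q) - qdiv q. bij_betw (qconj q z) (qdiv q) (qdiv q)
          \<and> (\<forall>n::nat. n \<ge> 1 \<longrightarrow> z [^]\<^bsub>qLaurent q\<^esub> n \<notin> qdiv q))
    \<and> (\<exists>z \<in> carrier (qLaurent q) - {\<zero>\<^bsub>qLaurent q\<^esub>}.
          qconj q z \<in> qdiv_End q \<and> qconj q z \<notin> qdiv_Aut q)"
proof -
  interpret quantum_torus q using assms by unfold_locales auto
  obtain v where v: "v \<notin> qdiv q" "bij_betw (cj v) (qdiv q) (qdiv q)" "v \<cdot> v \<in> qdiv q"
    using ex_bijective_square by blast
  have "v [^]\<^bsub>qLaurent q\<^esub> (2::nat) = v \<cdot> v" by (simp add: numeral_2_eq_2)
  then have "\<exists>n::nat. n > 0 \<and> v [^]\<^bsub>qLaurent q\<^esub> n \<in> qdiv q" using v(3) by (intro exI[of _ 2]) simp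
  then have 1: "\<exists>z \<in> carrier (qLaurent q) - qdiv q. bij_betw (qconj q z) (qdiv q) (qdiv q)
      \<and> (\<exists>n::nat. n > 0 \<and> z [^]\<^bsub>qLaurent q\<^esub> n \<in> qdiv q)"
    using v by (auto simp: qconj_eq)
  have 2: "\<exists>z \<in> carrier (qLaurent q) - qdiv q. bij_betw (qconj q z) (qdiv q) (qdiv q)
      \<and> (\<forall>n::nat. n \<ge> 1 \<longrightarrow> z [^]\<^bsub>qLaurent q\<^esub> n \<notin> qdiv q)"
    using ex_bijective_no_power by (auto simp: qconj_eq)
  obtain w where w: "w \<noteq> 0" "cj w ` qdiv q \<subset> qdiv q" using ex_nonsurjective by blast
  then have "qconj q w \<in> qdiv_End q" "qconj q w \<notin> qdiv_Aut q"
    using qconj_End[of w] by (auto simp: qdiv_Aut_def bij_betw_def qconj_eq)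
  then have "\<exists>z \<in> carrier (qLaurent q) - {\<zero>\<^bsub>qLaurent q\<^esub>}.
          qconj q z \<in> qdiv_End q \<and> qconj q z \<notin> qdiv_Aut q"
    using w(1) by auto
  with 1 2 show ?thesis by blast
qed

end
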